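(* For each $N$ (in an unbounded set of positive integers) let $A_N$ be a real matrix with $N$ columns, of rank $r=r_N$, in general position, and let $u_0=u_0^{(N)}$ be a random binary signal in $\{0,1\}^N$ without preference on orthants. Let $p_N$ be the probability that $u_0$ can be recovered from the linear problem $(P_1)$, i.e. that $u=u_0$ is the unique $u\in\mathbb{R}^N$ with $A_Nu=A_Nu_0$ and $0\le u\le 1$ componentwise. Then: (1) for large $N$, $p_N$ is approximated by $\Phi\!\left(\frac{2r-N-1}{\sqrt{N-1}}\right)$, in the sense that $$p_N-\Phi\!\left(\frac{2r_N-N-1}{\sqrt{N-1}}\right)\to 0\quad\text{as } N\to\infty,$$ where $\Phi(x)=\frac{1}{\sqrt{2\pi}}\int_{-\infty}^x e^{-t^2/2}\,dt$; (2) if $\frac{r_N-1}{N-1}\to\rho>\frac12$ as $N\to\infty$, then for all sufficiently large $N$, $$p_N\ \ge\ 1-\tfrac12 e^{-c(N-1)},\qquad c=\left(\rho-\tfrac12\right)^2 .$$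
   Context: An $s$-dimensional linear subspace of $\mathbb{R}^N$ is in general position if the orthogonal projections onto it of any $s$ of the $N$ coordinate axes (standard basis vectors) are linearly independent. A matrix $A$ with $N$ columns is in general position if its kernel $\ker A\subset\mathbb{R}^N$ is in general position. For a binary $u_0\in\{0,1\}^N$, let $\mathbb{O}_{u_0}=\{v\in\mathbb{R}^N: v(x)\le 0 \text{ when } u_0(x)=1,\ v(x)\ge 0\text{ when }u_0(x)=0\}$, a closed orthant of $\mathbb{R}^N$. A random binary signal $u_0$ is without preference on orthants if for any two closed orthants $\mathbb{O}_1,\mathbb{O}_2$ of $\mathbb{R}^N$, $\mathrm{Prob}(\mathbb{O}_{u_0}\in\{\mathbb{O}_1,-\mathbb{O}_1\})=\mathrm{Prob}(\mathbb{O}_{u_0}\in\{\mathbb{O}_2,-\mathbb{O}_2\})$. *)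

theory Defs
  imports
    "HOL-Probability.Probability"
    "Jordan_Normal_Form.DL_Rank"
    "Jordan_Normal_Form.Matrix_Kernel"
begin

text \<open>
  The dimension \<open>N\<close> varies inside the statement, so \<open>\<real>\<^sup>N\<close> is
  \<^term>\<open>carrier_vec N :: real vec set\<close>, with components indexed by \<open>x < N\<close>.
\<close>

abbreviation euclid :: "nat \<Rightarrow> (real, real vec) module" where
  "euclid N \<equiv> module_vec TYPE(real) N"

definition subspace_dim :: "nat \<Rightarrow> real vec set \<Rightarrow> nat" where
  "subspace_dim N L = vectorspace.dim class_ring ((euclid N)\<lparr>carrier := L\<rparr>)"

definition orth_proj :: "real vec set \<Rightarrow> real vec \<Rightarrow> real vec" where
  "orth_proj L v = (THE p. p \<in> L \<and> (\<forall>w\<in>L. (v - p) \<bullet> w = 0))"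

text \<open>
  Linear independence in the library is a property of sets. Here it is required of the family
  of projections indexed by the axes in \<open>I\<close>, hence the additional injectivity: two axes with the
  same projection are dependent.
\<close>

definition general_position :: "nat \<Rightarrow> real vec set \<Rightarrow> bool" where
  "general_position N L \<longleftrightarrow>
     VectorSpace.subspace class_ring L (euclid N) \<and>
     (\<forall>I. I \<subseteq> {..<N} \<and> card I = subspace_dim N L \<longrightarrow>
        inj_on (\<lambda>i. orth_proj L (unit_vec N i)) I \<and>
        \<not> module.lin_dep class_ring (euclid N) ((\<lambda>i. orth_proj L (unit_vec N i)) ` I))"

definition mat_general_position :: "real mat \<Rightarrow> bool" where
  "mat_general_position A \<longleftrightarrow> general_position (dim_col A) (mat_kernel A)"

definition mat_rank :: "real mat \<Rightarrow> nat" where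
  "mat_rank A = vec_space.rank (dim_row A) A"

definition binary_vecs :: "nat \<Rightarrow> real vec set" where
  "binary_vecs N = {u \<in> carrier_vec N. \<forall>x<N. vec_index u x \<in> {0, 1}}"

definition signal_orthant :: "nat \<Rightarrow> real vec \<Rightarrow> real vec set" where
  "signal_orthant N u0 = {v \<in> carrier_vec N. \<forall>x<N.
     (vec_index u0 x = 1 \<longrightarrow> vec_index v x \<le> 0) \<and> (vec_index u0 x = 0 \<longrightarrow> vec_index v x \<ge> 0)}"

definition closed_orthants :: "nat \<Rightarrow> real vec set set" where
  "closed_orthants N =
     {{v \<in> carrier_vec N. \<forall>x<N. \<epsilon> x * vec_index v x \<ge> 0} | \<epsilon>. \<forall>x<N. \<epsilon> x \<in> {-1, 1::real}}"

definition random_binary_signal :: "nat \<Rightarrow> 'a measure \<Rightarrow> ('a \<Rightarrow> real vec) \<Rightarrow> bool" where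
  "random_binary_signal N M u0 \<longleftrightarrow> prob_space M \<and> u0 \<in> M \<rightarrow>\<^sub>M count_space (binary_vecs N)"

text \<open>Here \<^term>\<open>uminus ` Q\<close> is the reflected orthant \<open>-Q\<close>.\<close>

definition without_orthant_preference :: "nat \<Rightarrow> 'a measure \<Rightarrow> ('a \<Rightarrow> real vec) \<Rightarrow> bool" where
  "without_orthant_preference N M u0 \<longleftrightarrow>
     (\<forall>Q1 \<in> closed_orthants N. \<forall>Q2 \<in> closed_orthants N.
        measure M {\<omega> \<in> space M. signal_orthant N (u0 \<omega>) \<in> {Q1, uminus ` Q1}} =
        measure M {\<omega> \<in> space M. signal_orthant N (u0 \<omega>) \<in> {Q2, uminus ` Q2}})"

definition feasible :: "real mat \<Rightarrow> real vec \<Rightarrow> real vec set" where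
  "feasible A u0 = {u \<in> carrier_vec (dim_col A).
     A *\<^sub>v u = A *\<^sub>v u0 \<and> (\<forall>x<dim_col A. 0 \<le> vec_index u x \<and> vec_index u x \<le> 1)}"

definition recoverable :: "real mat \<Rightarrow> real vec \<Rightarrow> bool" where
  "recoverable A u0 \<longleftrightarrow> feasible A u0 = {u0}"

definition recovery_prob :: "'a measure \<Rightarrow> real mat \<Rightarrow> ('a \<Rightarrow> real vec) \<Rightarrow> real" where
  "recovery_prob M A u0 = measure M {\<omega> \<in> space M. recoverable A (u0 \<omega>)}"

definition Phi :: "real \<Rightarrow> real" where
  "Phi x = 1 / sqrt (2 * pi) * (LINT t:{..x}|lborel. exp (- t\<^sup>2 / 2))"

text \<open>The filter of \<open>N \<rightarrow> \<infinity>\<close> along the index set \<open>S\<close>.\<close>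

definition at_infinity_in :: "nat set \<Rightarrow> nat filter" where
  "at_infinity_in S = inf sequentially (principal S)"

end

theory Submission
  imports Defs "HOL-Real_Asymp.Real_Asymp"
begin

text \<open>
  A binary signal \<open>u\<close> fails to be recoverable iff the kernel \<open>L\<close>, of dimension \<open>s = N - r\<close>, meets
  the closed orthant of \<open>u\<close> outside \<open>0\<close>. General position says that \<open>s\<close> coordinates can be prescribed
  freely and determine a vector of \<open>L\<close>; hence closed orthants may be replaced by open ones, and
  deletion-restriction (Schlaefli, Cover) shows that \<open>L\<close> meets exactly
  \<open>2 * (\<Sum>k<s. (N - 1) choose k)\<close> of them. As the pairs of opposite orthants are equally likely, the
  success probability is \<open>P(B < r)\<close> for \<open>B\<close> binomial with parameters \<open>N - 1\<close> and \<open>1/2\<close>. Part (1) is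
  then the central limit theorem, made uniform in the argument of the distribution function
  because \<open>r\<close> depends on \<open>N\<close>, and part (2) is Hoeffding's inequality.
\<close>

unbundle no inner_syntax and no vec_syntax

section \<open>Sign patterns of a generic subspace\<close>

text \<open>Plain functions on an index type stand in for vectors, so that coordinates can be
  deleted one at a time without changing the ambient space.\<close>

definition lin_closed :: "('i \<Rightarrow> real) set \<Rightarrow> bool" where
  "lin_closed L \<longleftrightarrow> (\<forall>u\<in>L. \<forall>v\<in>L. \<forall>a b. (\<lambda>i. a * u i + b * v i) \<in> L)"

text \<open>Restricting \<open>L\<close> to at most \<open>s\<close> coordinates is onto, and
  restricting it to exactly \<open>s\<close> coordinates is injective up to values outside
  \<open>I\<close>: the uniform matroid of rank \<open>s\<close>. When \<open>I\<close> has fewer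
  than \<open>s\<close> elements the second clause is vacuous, so the same \<open>s\<close> survives
  the deletion of coordinates.\<close>

definition generic_on :: "'i set \<Rightarrow> ('i \<Rightarrow> real) set \<Rightarrow> nat \<Rightarrow> bool" where
  "generic_on I L s \<longleftrightarrow>
     (\<forall>J g. J \<subseteq> I \<and> card J \<le> s \<longrightarrow> (\<exists>v\<in>L. \<forall>j\<in>J. v j = g j)) \<and>
     (\<forall>J v. J \<subseteq> I \<and> card J = s \<and> v \<in> L \<and> (\<forall>j\<in>J. v j = 0) \<longrightarrow> (\<forall>i\<in>I. v i = 0))"

definition has_pattern :: "'i set \<Rightarrow> ('i \<Rightarrow> real) \<Rightarrow> 'i set \<Rightarrow> bool" where
  "has_pattern I v X \<longleftrightarrow> (\<forall>i\<in>X. v i > 0) \<and> (\<forall>i\<in>I - X. v i < 0)"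

definition patterns :: "'i set \<Rightarrow> ('i \<Rightarrow> real) set \<Rightarrow> 'i set set" where
  "patterns I L = {X. X \<subseteq> I \<and> (\<exists>v\<in>L. has_pattern I v X)}"

lemma lin_closedD: "lin_closed L \<Longrightarrow> u \<in> L \<Longrightarrow> v \<in> L \<Longrightarrow> (\<lambda>i. a * u i + b * v i) \<in> L"
  unfolding lin_closed_def by blast

lemma generic_on_surj:
  "generic_on I L s \<Longrightarrow> J \<subseteq> I \<Longrightarrow> card J \<le> s \<Longrightarrow> \<exists>v\<in>L. \<forall>j\<in>J. v j = g j"
  unfolding generic_on_def by blast

lemma generic_on_inj:
  "generic_on I L s \<Longrightarrow> J \<subseteq> I \<Longrightarrow> card J = s \<Longrightarrow> v \<in> L \<Longrightarrow> (\<And>j. j \<in> J \<Longrightarrow> v j = 0)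
    \<Longrightarrow> i \<in> I \<Longrightarrow> v i = 0"
  unfolding generic_on_def by blast

lemma patterns_subset: "X \<in> patterns I (L :: ('i \<Rightarrow> real) set) \<Longrightarrow> X \<subseteq> I"
  by (simp add: patterns_def)

lemma generic_on_subset:
  assumes g: "generic_on I L s" and K: "K \<subseteq> I" shows "generic_on K L s"
  unfolding generic_on_def
proof (intro conjI allI impI ballI)
  fix J h assume "J \<subseteq> K \<and> card J \<le> s"
  then show "\<exists>v\<in>L. \<forall>j\<in>J. v j = h j" using generic_on_surj[OF g, of J h] K by auto
next
  fix J v i assume "J \<subseteq> K \<and> card J = s \<and> v \<in> L \<and> (\<forall>j\<in>J. v j = 0)" "i \<in> K"
  then show "v i = 0" using generic_on_inj[OF g, of J v i] K by auto
qed

text \<open>Adjoining \<open>i\<close> to \<open>J\<close> turns a condition on \<open>s\<close>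
  coordinates of the hyperplane into one on \<open>Suc s\<close> coordinates of
  \<open>L\<close>.\<close>

lemma generic_on_hyperplane:
  assumes g: "generic_on (insert i I) L (Suc s)" and i: "i \<notin> I" and fin: "finite I"
  shows "generic_on I {v\<in>L. v i = 0} s"
  unfolding generic_on_def
proof (intro conjI allI impI)
  fix J and h :: "'a \<Rightarrow> real" assume J: "J \<subseteq> I \<and> card J \<le> s"
  then have "card (insert i J) \<le> Suc s" by (metis card_insert_le_m1 diff_Suc_1 zero_less_Suc)
  moreover have "insert i J \<subseteq> insert i I" using J by blast
  ultimately obtain v where "v \<in> L" "\<forall>j\<in>insert i J. v j = (h(i := 0)) j"
    using generic_on_surj[OF g, of "insert i J" "h(i := 0)"] by blast
  then show "\<exists>v\<in>{v \<in> L. v i = 0}. \<forall>j\<in>J. v j = h j"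
    using J i by (intro bexI[of _ v]) auto
next
  fix J v assume J: "J \<subseteq> I \<and> card J = s \<and> v \<in> {v \<in> L. v i = 0} \<and> (\<forall>j\<in>J. v j = 0)"
  then have "card (insert i J) = Suc s" using i fin by (subst card_insert_disjoint) (auto intro: finite_subset)
  then show "\<forall>i\<in>I. v i = 0"
    using generic_on_inj[OF g, of "insert i J" v] J by auto
qed

lemma lin_closed_hyperplane: "lin_closed L \<Longrightarrow> lin_closed {v\<in>L. v i = 0}"
  unfolding lin_closed_def by auto

text \<open>Strict signs are an open condition and \<open>I\<close> is finite. Both directions are
  recorded because both sides of a wall have to be reached with the same step.\<close>

lemma small_perturbation:
  fixes v w :: "'i \<Rightarrow> real"
  assumes "finite I"
  shows "\<exists>t>0. \<forall>i\<in>I. (v i > 0 \<longrightarrow> v i + t * w i > 0 \<and> v i - t * w i > 0) \<and>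
                      (v i < 0 \<longrightarrow> v i + t * w i < 0 \<and> v i - t * w i < 0)"
proof -
  have "\<forall>\<^sub>F t in at_right 0. (v i > 0 \<longrightarrow> v i + t * w i > 0 \<and> v i - t * w i > 0) \<and>
                      (v i < 0 \<longrightarrow> v i + t * w i < 0 \<and> v i - t * w i < 0)" for i
  proof -
    have p: "((\<lambda>t. v i + t * w i) \<longlongrightarrow> v i + 0 * w i) (at_right 0)"
         "((\<lambda>t. v i - t * w i) \<longlongrightarrow> v i - 0 * w i) (at_right 0)"
      by (intro tendsto_intros)+
    have q: "v i > 0 \<Longrightarrow> \<forall>\<^sub>F t in at_right 0. v i + t * w i > 0 \<and> v i - t * w i > 0"
      using order_tendstoD(1)[OF p(1), of 0] order_tendstoD(1)[OF p(2), of 0]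
      by (simp add: eventually_conj_iff)
    have r: "v i < 0 \<Longrightarrow> \<forall>\<^sub>F t in at_right 0. v i + t * w i < 0 \<and> v i - t * w i < 0"
      using order_tendstoD(2)[OF p(1), of 0] order_tendstoD(2)[OF p(2), of 0]
      by (simp add: eventually_conj_iff)
    show ?thesis
      by (cases "v i" "0::real" rule: linorder_cases) (use q r in auto)
  qed
  then have "\<forall>\<^sub>F t in at_right 0. \<forall>i\<in>I. (v i > 0 \<longrightarrow> v i + t * w i > 0 \<and> v i - t * w i > 0) \<and>
                      (v i < 0 \<longrightarrow> v i + t * w i < 0 \<and> v i - t * w i < 0)"
    using assms by (simp add: eventually_ball_finite)
  moreover have "\<forall>\<^sub>F t in at_right (0::real). t > 0" by (simp add: eventually_at_right_less)
  ultimately have "\<forall>\<^sub>F t in at_right (0::real). t > 0 \<and> (\<forall>i\<in>I. (v i > 0 \<longrightarrow> v i + t * w i > 0 \<and> v i - t * w i > 0) \<and>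
                      (v i < 0 \<longrightarrow> v i + t * w i < 0 \<and> v i - t * w i < 0))"
    by (rule eventually_conj[rotated])
  then show ?thesis by (rule eventually_happens'[rotated]) simp
qed

text \<open>Injectivity at the empty \<open>J\<close> makes every member of \<open>L\<close> vanish
  on \<open>I\<close>; this matches the empty binomial sum.\<close>

lemma patterns_zero:
  assumes "generic_on I L 0" "I \<noteq> {}"
  shows "patterns I L = {}"
  using assms generic_on_inj[OF assms(1), of "{}"]
  by (fastforce simp: patterns_def has_pattern_def)

text \<open>Leaving the wall \<open>v i = 0\<close> along \<open>w\<close>, forwards or backwards,
  gives coordinate \<open>i\<close> either sign, and a short step disturbs no other sign.\<close>

lemma pattern_perturb:
  assumes L: "lin_closed L" and fin: "finite I" and i: "i \<notin> I"
    and v: "v \<in> L" "has_pattern I v X" "v i = 0" and w: "w \<in> L" "w i = 1" and X: "X \<subseteq> I"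
  shows "X \<in> patterns (insert i I) L" "insert i X \<in> patterns (insert i I) L"
proof -
  obtain t where t: "t > 0" "\<And>j. j \<in> I \<Longrightarrow> (v j > 0 \<longrightarrow> v j + t * w j > 0 \<and> v j - t * w j > 0) \<and>
                      (v j < 0 \<longrightarrow> v j + t * w j < 0 \<and> v j - t * w j < 0)"
    using small_perturbation[OF fin, of v w] by auto
  have m: "(\<lambda>j. 1 * v j + t * w j) \<in> L" "(\<lambda>j. 1 * v j + (-t) * w j) \<in> L"
    using lin_closedD[OF L v(1) w(1)] by blast+
  show "X \<in> patterns (insert i I) L"
    using m(2) v t X i w(2) unfolding patterns_def has_pattern_def
    by (intro CollectI conjI bexI[of _ "\<lambda>j. 1 * v j + (-t) * w j"]) auto
  show "insert i X \<in> patterns (insert i I) L"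
    using m(1) v t X i w(2) unfolding patterns_def has_pattern_def
    by (intro CollectI conjI bexI[of _ "\<lambda>j. 1 * v j + t * w j"]) auto
qed

lemma has_pattern_subset: "i \<notin> I \<Longrightarrow> has_pattern (insert i I) v X \<Longrightarrow> has_pattern I v (X - {i})"
  by (auto simp: has_pattern_def)

text \<open>A segment between two vectors that differ in sign only at \<open>i\<close> crosses the
  wall at a point keeping the common signs; conversely a point of the wall can be pushed to both
  sides.\<close>

lemma patterns_both_iff:
  assumes L: "lin_closed L" and fin: "finite I" and i: "i \<notin> I" and w: "w \<in> L" "w i = 1" and X: "X \<subseteq> I"
  shows "X \<in> patterns (insert i I) L \<and> insert i X \<in> patterns (insert i I) L
           \<longleftrightarrow> X \<in> patterns I {v\<in>L. v i = 0}" (is "?A \<longleftrightarrow> ?B")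
proof
  assume ?A
  then obtain u v where u: "u \<in> L" "has_pattern (insert i I) u X"
    and v: "v \<in> L" "has_pattern (insert i I) v (insert i X)"
    by (auto simp: patterns_def)
  have s: "u i < 0" "v i > 0" using u v i X by (auto simp: has_pattern_def)
  \<comment> \<open>Both coefficients are positive and chosen so that the combination vanishes at
    \<open>i\<close>.\<close>
  let ?z = "\<lambda>j. v i * u j + (- u i) * v j"
  have "?z \<in> L" using lin_closedD[OF L] u v by blast
  moreover have "has_pattern I ?z X"
    unfolding has_pattern_def
  proof safe
    fix j assume "j \<in> X"
    then have "u j > 0" "v j > 0" using u v by (auto simp: has_pattern_def)
    then show "?z j > 0" using s by (intro add_pos_pos mult_pos_pos) auto
  next
    fix j assume "j \<in> I" "j \<notin> X"
    then have "u j < 0" "v j < 0" using u v i by (auto simp: has_pattern_def)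
    then show "?z j < 0" using s by (intro add_neg_neg mult_pos_neg) auto
  qed
  ultimately show ?B using X by (auto simp: patterns_def intro!: bexI[of _ ?z])
next
  assume ?B
  then obtain v where "v \<in> L" "v i = 0" "has_pattern I v X" by (auto simp: patterns_def)
  then show ?A using pattern_perturb[OF L fin i _ _ _ w X] by blast
qed

text \<open>A vector with pattern \<open>X\<close> on \<open>I\<close> either has a sign at
  \<open>i\<close> already or lies on the wall and can be pushed off it.\<close>

lemma patterns_either_iff:
  assumes L: "lin_closed L" and fin: "finite I" and i: "i \<notin> I" and w: "w \<in> L" "w i = 1" and X: "X \<subseteq> I"
  shows "X \<in> patterns (insert i I) L \<or> insert i X \<in> patterns (insert i I) L
           \<longleftrightarrow> X \<in> patterns I L" (is "?A \<longleftrightarrow> ?B")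
proof
  have "i \<notin> X" using X i by auto
  then show "?A \<Longrightarrow> ?B"
    using has_pattern_subset[of i I _ X] has_pattern_subset[of i I _ "insert i X"] X i
    by (auto simp: patterns_def insert_Diff_if)
next
  assume ?B
  then obtain v where v: "v \<in> L" "has_pattern I v X" by (auto simp: patterns_def)
  show ?A
  proof (cases "v i" "0::real" rule: linorder_cases)
    case less
    then have "has_pattern (insert i I) v X" using v X i by (auto simp: has_pattern_def)
    then show ?thesis using v X by (auto simp: patterns_def)
  next
    case equal
    then show ?thesis using pattern_perturb[OF L fin i v _ w X] by blast
  next
    case greater
    then have "has_pattern (insert i I) v (insert i X)" using v X i by (auto simp: has_pattern_def)
    then have "insert i X \<in> patterns (insert i I) L" using v X by (auto simp: patterns_def)
    then show ?thesis ..
  qed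
qed

text \<open>Deletion and restriction: every pattern on \<open>I\<close> extends over the new coordinate \<open>i\<close>,
  and it extends with both signs iff it occurs in the hyperplane \<open>v i = 0\<close>.\<close>

lemma card_patterns_insert:
  assumes L: "lin_closed L" and fin: "finite I" and i: "i \<notin> I" and w: "w \<in> L" "w i = 1"
  shows "card (patterns (insert i I) L) = card (patterns I L) + card (patterns I {v\<in>L. v i = 0})"
proof -
  let ?P = "patterns (insert i I) L"
  \<comment> \<open>The patterns are split by their sign at \<open>i\<close>, with \<open>i\<close>
    itself removed. The union of the two families is then the deletion and their intersection the
    restriction.\<close>
  define U where "U = {X. X \<subseteq> I \<and> X \<in> ?P}"
  define W where "W = {X. X \<subseteq> I \<and> insert i X \<in> ?P}"
  have f: "finite U" "finite W" using fin by (auto simp: U_def W_def)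
  have P: "?P = U \<union> insert i ` W"
  proof (intro equalityI subsetI)
    fix X assume X: "X \<in> ?P"
    then have "X \<subseteq> insert i I" by (auto simp: patterns_def)
    then show "X \<in> U \<union> insert i ` W"
      using X by (cases "i \<in> X") (auto simp: U_def W_def insert_absorb intro!: image_eqI[of _ _ "X - {i}"])
  qed (auto simp: U_def W_def)
  have "card ?P = card U + card (insert i ` W)"
    unfolding P using f i by (intro card_Un_disjoint) (auto simp: U_def)
  also have "card (insert i ` W) = card W"
  proof (rule card_image, rule inj_onI)
    fix X Y assume "X \<in> W" "Y \<in> W" "insert i X = insert i Y"
    then show "X = Y" using i unfolding W_def by (metis (no_types, lifting) insert_ident mem_Collect_eq subsetD)
  qed
  also have "card U + card W = card (U \<union> W) + card (U \<inter> W)"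
    using card_Un_Int[OF f] .
  also have "U \<union> W = patterns I L"
    using patterns_either_iff[OF L fin i w] patterns_subset[of _ I L] unfolding U_def W_def by blast
  also have "U \<inter> W = patterns I {v\<in>L. v i = 0}"
    using patterns_both_iff[OF L fin i w] patterns_subset[of _ I "{v\<in>L. v i = 0}"]
    unfolding U_def W_def by blast
  finally show ?thesis .
qed

text \<open>Pascal's rule summed over \<open>k\<close>, which is the recursion of
  \<open>card_patterns_insert\<close>.\<close>

lemma sum_choose_Suc: "(\<Sum>k<Suc s. Suc n choose k) = (\<Sum>k<Suc s. n choose k) + (\<Sum>k<s. n choose k)"
  by (induction s) auto

text \<open>Induction over the coordinates. \<open>L\<close> and \<open>s\<close> stay arbitrary
  because restriction to a wall replaces \<open>L\<close> by a hyperplane and lowers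
  \<open>s\<close> by one, while deletion keeps both.\<close>

theorem card_patterns:
  assumes "finite I" "I \<noteq> {}" "lin_closed L" "generic_on I L s"
  shows "card (patterns I L) = 2 * (\<Sum>k<s. (card I - 1) choose k)"
  using assms
proof (induction I arbitrary: L s rule: finite_ne_induct)
  case (singleton i)
  show ?case
  proof (cases s)
    case 0
    then show ?thesis using patterns_zero[of "{i}" L] singleton by auto
  next
    case (Suc t)
    then have sur: "\<exists>v\<in>L. v i = c" for c
      using generic_on_surj[OF singleton(2), of "{i}" "\<lambda>_. c"] by auto
    obtain v u where "v \<in> L" "v i = 1" "u \<in> L" "u i = -1" using sur by metis
    then have "patterns {i} L = {{}, {i}}"
      unfolding patterns_def has_pattern_def
      by (auto intro: bexI[of _ v] bexI[of _ u])
    moreover have "(\<Sum>k<Suc t. 0 choose k) = (1::nat)"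
      by (induction t) auto
    ultimately show ?thesis using Suc by auto
  qed
next
  case (insert i I)
  show ?case
  proof (cases s)
    case 0
    then show ?thesis using patterns_zero[of "insert i I" L] insert by auto
  next
    case (Suc t)
    then obtain w where w: "w \<in> L" "w i = 1"
      using generic_on_surj[OF insert(6), of "{i}" "\<lambda>_. 1"] by auto
    obtain n where n: "card I = Suc n" using insert by (metis card_0_eq not0_implies_Suc)
    have "card (patterns I L) = 2 * (\<Sum>k<s. (card I - 1) choose k)"
      using insert.IH[OF insert.prems(1)] generic_on_subset[OF insert.prems(2)] by blast
    moreover have "card (patterns I {v\<in>L. v i = 0}) = 2 * (\<Sum>k<t. (card I - 1) choose k)"
      using insert.prems insert.hyps Suc
      by (intro insert.IH lin_closed_hyperplane generic_on_hyperplane) auto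
    ultimately show ?thesis
      using card_patterns_insert[OF insert.prems(1) insert.hyps(1,3) w] insert.hyps n Suc
      by (simp add: sum_choose_Suc del: sum.lessThan_Suc binomial_Suc_Suc)
  qed
qed

text \<open>The zero coordinates can be perturbed to any prescribed signs,
  since fewer than \<open>s\<close> coordinates of a nonzero vector vanish.\<close>

lemma closed_orthant_iff_patterns:
  assumes "finite I" "I \<noteq> {}" "lin_closed L" "generic_on I L s" "X \<subseteq> I"
  shows "(\<exists>v\<in>L. (\<exists>i\<in>I. v i \<noteq> 0) \<and> (\<forall>i\<in>X. v i \<ge> 0) \<and> (\<forall>i\<in>I-X. v i \<le> 0)) \<longleftrightarrow> X \<in> patterns I L"
    (is "?A \<longleftrightarrow> ?B")
proof
  assume ?A
  then obtain v where v: "v \<in> L" "\<exists>i\<in>I. v i \<noteq> 0" "\<And>i. i \<in> X \<Longrightarrow> v i \<ge> 0" "\<And>i. i \<in> I - X \<Longrightarrow> v i \<le> 0"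
    by blast
  define Z where "Z = {i\<in>I. v i = 0}"
  have "card Z \<le> s"
  proof (rule ccontr)
    assume "\<not> card Z \<le> s"
    then obtain J where "J \<subseteq> Z" "card J = s" by (meson nat_le_linear obtain_subset_with_card_n)
    then have "v i = 0" if "i \<in> I" for i
      using v(1) generic_on_inj[OF assms(4), of J v i] that unfolding Z_def by blast
    then show False using v(2) by blast
  qed
  then obtain w where w: "w \<in> L" "\<And>j. j \<in> Z \<Longrightarrow> w j = (if j \<in> X then 1 else -1)"
    using generic_on_surj[OF assms(4), of Z "\<lambda>j. if j \<in> X then 1 else -1"] by (auto simp: Z_def)
  obtain t where t: "t > 0" "\<And>j. j \<in> I \<Longrightarrow> (v j > 0 \<longrightarrow> v j + t * w j > 0) \<and> (v j < 0 \<longrightarrow> v j + t * w j < 0)"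
    using small_perturbation[OF assms(1), of v w] by auto
  have "(\<lambda>j. 1 * v j + t * w j) \<in> L" using lin_closedD[OF assms(3)] v w by blast
  moreover have "has_pattern I (\<lambda>j. 1 * v j + t * w j) X"
    unfolding has_pattern_def
  proof safe
    fix j assume "j \<in> X" then show "1 * v j + t * w j > 0"
      using v(3)[of j] t w(2)[of j] assms(5) by (cases "v j = 0") (auto simp: Z_def)
  next
    fix j assume "j \<in> I" "j \<notin> X" then show "1 * v j + t * w j < 0"
      using v(4)[of j] t w(2)[of j] by (cases "v j = 0") (auto simp: Z_def)
  qed
  ultimately show ?B using assms(5) by (auto simp: patterns_def intro!: bexI[of _ "\<lambda>j. 1 * v j + t * w j"])
next
  assume ?B
  then obtain v where v: "v \<in> L" "has_pattern I v X" by (auto simp: patterns_def)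
  obtain i where "i \<in> I" using assms(2) by auto
  then have "v i \<noteq> 0" using v(2) by (cases "i \<in> X") (force simp: has_pattern_def)+
  then show ?A using v \<open>i \<in> I\<close>
    by (intro bexI[of _ v]) (auto simp: has_pattern_def intro: less_imp_le)
qed

section \<open>Subspaces of Euclidean space\<close>

context vec_space
begin

lemma subspace_closed:
  assumes "VectorSpace.subspace class_ring L V"
  shows "L \<subseteq> carrier_vec n" "0\<^sub>v n \<in> L" "\<And>u v. u \<in> L \<Longrightarrow> v \<in> L \<Longrightarrow> u + v \<in> L"
    "\<And>c v. v \<in> L \<Longrightarrow> c \<cdot>\<^sub>v v \<in> L"
  using submodule.subset[of class_ring L V] submodule.zero_closed[of class_ring L V]
    submodule.m_closed[of class_ring L V] submodule.smult_closed[of class_ring L V] is_module[OF assms]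
  by auto

text \<open>Independent subsets of \<open>L\<close> have at most \<open>n\<close> elements, so a
  maximal one exists; it is a basis of \<open>L\<close> as a space in its own right, and span and
  independence agree with those of the ambient space.\<close>

lemma subspace_basis:
  assumes L: "VectorSpace.subspace class_ring L V"
  obtains B where "finite B" "B \<subseteq> L" "lin_indpt B" "span B = L"
    "vectorspace.dim class_ring (vs L) = card B"
proof -
  have Lc: "L \<subseteq> carrier_vec n" using subspace_closed[OF L] by blast
  interpret W: vectorspace class_ring "vs L" using subspace_is_vs[OF L] .
  have sub: "submodule class_ring L V" using L by simp
  have li: "W.lin_indpt S \<longleftrightarrow> lin_indpt S" if "S \<subseteq> L" for S
    using span_li_not_depend(2)[OF that sub] by simp
  have fc: "finite S \<and> card S \<le> n" if "S \<subseteq> L \<and> lin_indpt S" for S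
  proof -
    have c: "S \<subseteq> carrier_vec n" using that Lc by blast
    show ?thesis using li_le_dim[OF fin_dim c] that dim_is_n by simp
  qed
  have "{} \<subseteq> L \<and> lin_indpt {}" by (simp add: lin_dep_def)
  then obtain B where B: "finite B" "maximal B (\<lambda>S. S \<subseteq> L \<and> lin_indpt S)"
    using maximal_exists[of "\<lambda>S. S \<subseteq> L \<and> lin_indpt S" n "{}"] fc by blast
  have mx: "B \<subseteq> L" "lin_indpt B" using B by (auto simp: maximal_def)
  have "maximal B (\<lambda>S. S \<subseteq> carrier (vs L) \<and> W.lin_indpt S)"
    using B(2) li unfolding maximal_def by auto
  then have "W.basis B" by (rule W.max_li_is_basis)
  then have "W.span B = L" "W.dim = card B" using W.dim_basis[OF B(1)] by (auto simp: W.basis_def)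
  then show ?thesis using that[OF B(1) mx] span_li_not_depend(1)[OF mx(1) sub] by simp
qed

lemma subspace_dim_le:
  assumes "VectorSpace.subspace class_ring L V"
  shows "vectorspace.dim class_ring (vs L) \<le> n"
proof -
  obtain B where B: "finite B" "B \<subseteq> L" "lin_indpt B" "vectorspace.dim class_ring (vs L) = card B"
    using subspace_basis[OF assms] by metis
  then have "B \<subseteq> carrier_vec n" using subspace_closed(1)[OF assms] by blast
  then show ?thesis using li_le_dim(2)[OF fin_dim _ B(3)] B(4) dim_is_n by simp
qed

text \<open>Used to see that \<open>s\<close> independent projected axes span the whole
  kernel.\<close>

lemma indpt_card_dim_spans:
  assumes L: "VectorSpace.subspace class_ring L V" and P: "finite P" "P \<subseteq> L" "lin_indpt P"
    "card P = vectorspace.dim class_ring (vs L)"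
  shows "span P = L"
proof -
  interpret W: vectorspace class_ring "vs L" using subspace_is_vs[OF L] .
  have sub: "submodule class_ring L V" using L by simp
  obtain B where B: "finite B" "B \<subseteq> L" "span B = L" using subspace_basis[OF L] by metis
  have "W.fin_dim"
    unfolding W.fin_dim_def using B span_li_not_depend(1)[OF B(2) sub] by auto
  moreover have "W.lin_indpt P" using span_li_not_depend(2)[OF P(2) sub] P(3) by simp
  ultimately have "W.basis P" using P by (intro W.dim_li_is_basis) auto
  then show ?thesis using span_li_not_depend(1)[OF P(2) sub] by (auto simp: W.basis_def)
qed

text \<open>Rank-nullity for the map \<open>v\<close> to \<open>A *\<^sub>v v\<close>: its image is
  the column space, whose dimension is the rank.\<close>

lemma rank_nullity_mat:
  assumes A: "A \<in> carrier_mat nr n"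
  shows "vec_space.rank nr A + vectorspace.dim class_ring (vs (mat_kernel A)) = n"
proof -
  interpret R: vec_space f_ty nr .
  interpret T: linear_map class_ring V R.V "\<lambda>v. A *\<^sub>v v"
  proof (unfold_locales)
    show "(\<lambda>v. A *\<^sub>v v) \<in> module_hom class_ring V R.V"
      using A mult_add_distrib_mat_vec[OF A] mult_mat_vec[OF A]
      unfolding module_hom_def by auto
  qed
  have ker: "T.kerT = mat_kernel A"
    using A by (auto simp: T.ker_def mat_kernel[OF A])
  have im: "T.imT = R.span (set (cols A))"
  proof -
    have d: "dim_row A = nr" "dim_col A = n" using A by auto
    have "T.imT = (\<lambda>v. A *\<^sub>v v) ` carrier_vec n" by (simp add: T.im_def)
    also have "\<dots> = {y \<in> carrier_vec nr. \<exists>x\<in>carrier_vec n. A *\<^sub>v x = y}"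
      using mult_mat_vec_carrier[OF A] by blast
    finally show ?thesis using R.col_space_eq[OF A] unfolding R.col_space_def d by (rule trans[OF _ sym])
  qed
  show ?thesis
    using T.rank_nullity[OF fin_dim] unfolding ker im R.rank_def dim_is_n .
qed

end

section \<open>Orthogonal projections and coordinates on a subspace\<close>

lemma scalar_prod_self_eq_0_iff:
  fixes v :: "real vec"
  assumes "v \<in> carrier_vec n"
  shows "v \<bullet> v = 0 \<longleftrightarrow> v = 0\<^sub>v n"
proof
  assume "v \<bullet> v = 0"
  then have "(\<Sum>i\<in>{0..<n}. v $ i * v $ i) = 0" using assms by (simp add: scalar_prod_def)
  then have "\<forall>i\<in>{0..<n}. v $ i * v $ i = 0"
    by (subst (asm) sum_nonneg_eq_0_iff) auto
  then show "v = 0\<^sub>v n" using assms by (intro eq_vecI) auto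
qed (use assms in auto)

context
  fixes N :: nat
begin

interpretation V: vec_space "TYPE(real)" N .

lemma orthogonal_to_span:
  assumes "B \<subseteq> carrier_vec N" "x \<in> carrier_vec N" "\<And>w. w \<in> B \<Longrightarrow> x \<bullet> w = 0" "w \<in> V.span B"
  shows "x \<bullet> w = 0"
  using V.in_orthogonal_complement_span[OF assms(1)] assms(2-4)
  unfolding V.orthogonal_complement_def by blast

text \<open>One Gram-Schmidt step per vector: the new \<open>b\<close> is first made orthogonal to
  \<open>B\<close>, then the component of \<open>v\<close> along the residue is added to the
  projection found so far.\<close>

lemma orth_proj_span_exists:
  assumes "finite B" "B \<subseteq> carrier_vec N" "v \<in> carrier_vec N"
  shows "\<exists>p\<in>V.span B. \<forall>w\<in>B. (v - p) \<bullet> w = 0"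
  using assms
proof (induction B arbitrary: v)
  case empty
  have "0\<^sub>v N \<in> V.span {}" by (intro V.subspace_closed(2) V.span_is_subspace) simp
  then show ?case by auto
next
  case (insert b B)
  have B: "B \<subseteq> carrier_vec N" and b: "b \<in> carrier_vec N" using insert by auto
  obtain p where p: "p \<in> V.span B" "\<forall>w\<in>B. (v - p) \<bullet> w = 0" using insert.IH[OF B insert.prems(2)] by blast
  obtain q where q: "q \<in> V.span B" "\<forall>w\<in>B. (b - q) \<bullet> w = 0" using insert.IH[OF B b] by blast
  note v = insert.prems(2)
  have pc: "p \<in> carrier_vec N" and qc: "q \<in> carrier_vec N" using p q V.span_closed[OF B] by auto
  define b' where "b' = b - q"
  have b'c: "b' \<in> carrier_vec N" using b qc by (simp add: b'_def)
  \<comment> \<open>If \<open>b\<close> already lies in the span of \<open>B\<close>, then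
    \<open>b' = 0\<close>, division by zero gives \<open>c = 0\<close>, and the projection is
    unchanged.\<close>
  define c where "c = (v \<bullet> b') / (b' \<bullet> b')"
  define p' where "p' = p + c \<cdot>\<^sub>v b'"
  have p'c: "p' \<in> carrier_vec N" using pc b'c by (simp add: p'_def)
  have expand: "(v - p') \<bullet> w = (v - p) \<bullet> w - c * (b' \<bullet> w)" if "w \<in> carrier_vec N" for w
  proof -
    have "v - p' = (v - p) - c \<cdot>\<^sub>v b'"
      unfolding p'_def using v pc b'c by (intro eq_vecI) auto
    then show ?thesis
      using that v pc b'c by (simp add: minus_scalar_prod_distrib[of _ N])
  qed
  have orthB: "(v - p') \<bullet> w = 0" if "w \<in> B" for w
    using that expand[of w] B p(2) q(2) by (auto simp: b'_def)
  have orthS: "(v - p') \<bullet> w = 0" if "w \<in> V.span B" for w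
    using orthogonal_to_span[OF B _ orthB that] v p'c by simp
  \<comment> \<open>Since \<open>p\<close> lies in the span of \<open>B\<close>, subtracting it does
    not change the component of \<open>v\<close> along \<open>b'\<close>.\<close>
  have "b' \<bullet> p = 0" using orthogonal_to_span[OF B b'c _ p(1)] q(2) by (simp add: b'_def)
  then have "p \<bullet> b' = 0" using pc b'c by (simp add: comm_scalar_prod[of _ N])
  then have "(v - p') \<bullet> b' = v \<bullet> b' - c * (b' \<bullet> b')"
    using expand[OF b'c] v pc b'c by (simp add: minus_scalar_prod_distrib[of _ N])
  also have "\<dots> = 0"
    using scalar_prod_self_eq_0_iff[OF b'c] v by (cases "b' = 0\<^sub>v N") (auto simp: c_def)
  finally have ob': "(v - p') \<bullet> b' = 0" .
  have "(v - p') \<bullet> b = 0"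
  proof -
    have "b = b' + q" unfolding b'_def using b qc by (intro eq_vecI) auto
    then show ?thesis using ob' orthS[OF q(1)] v p'c b'c qc by (simp add: scalar_prod_add_distrib[of _ N])
  qed
  moreover have "p' \<in> V.span (insert b B)"
  proof -
    have sub: "VectorSpace.subspace class_ring (V.span (insert b B)) V.V"
      using insert.prems by (intro V.span_is_subspace) auto
    have mono: "V.span B \<subseteq> V.span (insert b B)" by (rule V.span_is_monotone) auto
    have "b \<in> V.span (insert b B)" using insert.prems by (intro V.span_mem) auto
    moreover have "b' = b + (-1) \<cdot>\<^sub>v q" unfolding b'_def using b qc by (intro eq_vecI) auto
    ultimately have "b' \<in> V.span (insert b B)" using q(1) mono V.subspace_closed(3,4)[OF sub] by auto
    then show ?thesis unfolding p'_def using p(1) mono V.subspace_closed(3,4)[OF sub] by auto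
  qed
  ultimately show ?case using orthB by (intro bexI[of _ p']) auto
qed

text \<open>Justifies the definite description in \<open>orth_proj\<close>: a finite basis of
  \<open>L\<close> gives existence, and the difference of two candidates lies in \<open>L\<close>
  and is orthogonal to itself.\<close>

lemma orth_proj_props:
  assumes L: "VectorSpace.subspace class_ring L V.V" and v: "v \<in> carrier_vec N"
  shows "orth_proj L v \<in> L" "\<And>w. w \<in> L \<Longrightarrow> orth_proj L v \<bullet> w = v \<bullet> w"
proof -
  obtain B where B: "finite B" "B \<subseteq> L" "V.span B = L" using V.subspace_basis[OF L] by metis
  note c = V.subspace_closed[OF L]
  have Bc: "B \<subseteq> carrier_vec N" using B c by blast
  obtain p where p: "p \<in> L" "\<forall>w\<in>B. (v - p) \<bullet> w = 0"
    using orth_proj_span_exists[OF B(1) Bc v] B(3) by blast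
  have pc: "p \<in> carrier_vec N" using p c by blast
  have po: "\<forall>w\<in>L. (v - p) \<bullet> w = 0"
  proof
    fix w assume w: "w \<in> L"
    have "v - p \<in> carrier_vec N" using v pc by simp
    then show "(v - p) \<bullet> w = 0"
      by (rule orthogonal_to_span[OF Bc]) (use p(2) w B(3) in blast)+
  qed
  have uniq: "p' = p" if p': "p' \<in> L \<and> (\<forall>w\<in>L. (v - p') \<bullet> w = 0)" for p'
  proof -
    have p'c: "p' \<in> carrier_vec N" using p' c by blast
    define d where "d = p' + (-1) \<cdot>\<^sub>v p"
    have d: "d \<in> L" unfolding d_def using p' p(1) c(3,4) by blast
    have dc: "d \<in> carrier_vec N" using d c by blast
    have "d = (v - p) - (v - p')" unfolding d_def using v pc p'c by (intro eq_vecI) auto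
    then have "d \<bullet> d = ((v - p) - (v - p')) \<bullet> d" by simp
    also have "\<dots> = (v - p) \<bullet> d - (v - p') \<bullet> d"
      using v pc p'c dc by (intro minus_scalar_prod_distrib[of _ N]) auto
    also have "\<dots> = 0" using d p' po by simp
    finally have d0: "d = 0\<^sub>v N" using scalar_prod_self_eq_0_iff[OF dc] by simp
    show "p' = p"
    proof (rule eq_vecI)
      fix i assume "i < dim_vec p"
      then show "p' $ i = p $ i" using arg_cong[OF d0, of "\<lambda>x. x $ i"] pc p'c by (simp add: d_def)
    qed (use pc p'c in auto)
  qed
  have "orth_proj L v = p" unfolding orth_proj_def using p(1) po uniq by (intro the_equality) blast+
  moreover have "p \<bullet> w = v \<bullet> w" if "w \<in> L" for w
  proof -
    have "w \<in> carrier_vec N" using that c by blast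
    then have "(v - p) \<bullet> w = v \<bullet> w - p \<bullet> w" using v pc by (intro minus_scalar_prod_distrib) auto
    then show ?thesis using po that by simp
  qed
  ultimately show "orth_proj L v \<in> L" "\<And>w. w \<in> L \<Longrightarrow> orth_proj L v \<bullet> w = v \<bullet> w" using p by auto
qed

end

text \<open>The cut-off makes \<open>coords N\<close> linear: entries of a vector beyond its dimension are unspecified.\<close>

definition coords :: "nat \<Rightarrow> real vec \<Rightarrow> nat \<Rightarrow> real" where
  "coords N v i = (if i < N then v $ i else 0)"

context
  fixes N :: nat
begin

interpretation V: vec_space "TYPE(real)" N .

lemma lin_closed_coords:
  assumes "VectorSpace.subspace class_ring L V.V"
  shows "lin_closed (coords N ` L)"
  unfolding lin_closed_def
proof (intro ballI allI)
  fix f g :: "nat \<Rightarrow> real" and a b :: real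
  assume "f \<in> coords N ` L" "g \<in> coords N ` L"
  then obtain u v where uv: "u \<in> L" "v \<in> L" "f = coords N u" "g = coords N v" by blast
  note c = V.subspace_closed[OF assms]
  have "u \<in> carrier_vec N" "v \<in> carrier_vec N" using uv c by auto
  then have "(\<lambda>i. a * f i + b * g i) = coords N (a \<cdot>\<^sub>v u + b \<cdot>\<^sub>v v)"
    unfolding uv by (auto simp: coords_def)
  then show "(\<lambda>i. a * f i + b * g i) \<in> coords N ` L" using uv c by auto
qed

text \<open>The projected axis \<open>i\<close> represents the \<open>i\<close>-th coordinate
  functional on \<open>L\<close>. Independence of projections thus becomes independence of
  coordinates.\<close>

lemma scalar_prod_orth_proj_unit:
  assumes "VectorSpace.subspace class_ring L V.V" "v \<in> L" "i < N"
  shows "orth_proj L (unit_vec N i) \<bullet> v = v $ i"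
proof -
  have "v \<in> carrier_vec N" using assms V.subspace_closed(1) by blast
  then show ?thesis
    using orth_proj_props(2)[OF assms(1) unit_vec_carrier assms(2)] assms(3) by simp
qed

text \<open>The residue \<open>d\<close> of the projected axis \<open>j\<close> modulo the span of the other
  projected axes is orthogonal to these but not to axis \<open>j\<close>; it is the dual basis vector.\<close>

lemma dual_basis_vector:
  assumes L: "VectorSpace.subspace class_ring L V.V" and J: "J \<subseteq> {..<N}"
    and inj: "inj_on (\<lambda>i. orth_proj L (unit_vec N i)) J"
    and indpt: "V.lin_indpt ((\<lambda>i. orth_proj L (unit_vec N i)) ` J)" and j: "j \<in> J"
  shows "\<exists>d\<in>L. \<forall>k\<in>J. d $ k = (if k = j then 1 else 0)"
proof -
  let ?p = "\<lambda>i. orth_proj L (unit_vec N i)"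
  let ?Q = "?p ` (J - {j})"
  note c = V.subspace_closed[OF L]
  have pL: "?p i \<in> L" for i using orth_proj_props(1)[OF L unit_vec_carrier] .
  have fin: "finite ?Q" using J finite_subset by blast
  have Qc: "?Q \<subseteq> carrier_vec N" using pL c by blast
  have pjc: "?p j \<in> carrier_vec N" using pL c by blast
  obtain q where q: "q \<in> V.span ?Q" "\<forall>w\<in>?Q. (?p j - q) \<bullet> w = 0"
    using orth_proj_span_exists[OF fin Qc pjc] by blast
  have QL: "V.span ?Q \<subseteq> L" using pL L by (intro V.span_is_subset) auto
  have qL: "q \<in> L" using q QL by blast
  have qc: "q \<in> carrier_vec N" using qL c by blast
  define d where "d = ?p j + (-1) \<cdot>\<^sub>v q"
  have dL: "d \<in> L" unfolding d_def using pL qL c(3,4) by blast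
  have dc: "d \<in> carrier_vec N" using dL c by blast
  have d_eq: "d = ?p j - q" unfolding d_def using pjc qc by (intro eq_vecI) auto
  have nin: "?p j \<notin> V.span ?Q"
  proof
    assume "?p j \<in> V.span ?Q"
    \<comment> \<open>Injectivity makes removing the index \<open>j\<close> the same as removing the
      vector \<open>?p j\<close>.\<close>
    moreover have "?Q = ?p ` J - {?p j}" using inj j by (auto simp: inj_on_def)
    ultimately have "\<exists>u\<in>?p ` J. u \<in> V.span (?p ` J - {u})" using j by (metis imageI)
    moreover have "?p ` J \<subseteq> carrier_vec N" using pL c(1) by (meson image_subsetI subsetD)
    moreover have "finite (?p ` J)" using J by (meson finite_imageI finite_lessThan finite_subset)
    ultimately show False using indpt V.lindep_span by metis
  qed
  have d0: "d \<noteq> 0\<^sub>v N"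
  proof
    assume d0: "d = 0\<^sub>v N"
    have "?p j = q"
    proof (rule eq_vecI)
      fix i assume "i < dim_vec q"
      then show "?p j $ i = q $ i" using arg_cong[OF d0, of "\<lambda>x. x $ i"] pjc qc by (simp add: d_eq)
    qed (use pjc qc in auto)
    then show False using nin q by simp
  qed
  have dk: "d $ k = 0" if "k \<in> J" "k \<noteq> j" for k
  proof -
    have "d \<bullet> ?p k = 0" using q(2) that by (auto simp: d_eq)
    moreover have "?p k \<in> carrier_vec N" using pL c by blast
    ultimately have "?p k \<bullet> d = 0" using dc by (simp add: comm_scalar_prod[of _ N])
    then show ?thesis using scalar_prod_orth_proj_unit[OF L dL, of k] that J by auto
  qed
  \<comment> \<open>As \<open>?p j\<close> is \<open>d\<close> plus a vector orthogonal to
    \<open>d\<close>, coordinate \<open>j\<close> of \<open>d\<close> equals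
    \<open>d \<bullet> d\<close>, which is nonzero.\<close>
  have "d \<bullet> q = 0" using orthogonal_to_span[OF Qc dc _ q(1)] q(2) by (simp add: d_eq)
  then have "q \<bullet> d = 0" using dc qc by (simp add: comm_scalar_prod[of _ N])
  then have "?p j \<bullet> d = d \<bullet> d"
    using pjc qc dc unfolding d_eq by (simp add: minus_scalar_prod_distrib[of _ N])
  then have dj: "d $ j \<noteq> 0"
    using scalar_prod_orth_proj_unit[OF L dL, of j] scalar_prod_self_eq_0_iff[OF dc] d0 j J by auto
  show ?thesis
  proof (intro bexI[of _ "(1 / d $ j) \<cdot>\<^sub>v d"] ballI)
    fix k assume "k \<in> J"
    moreover have "k < dim_vec d" using \<open>k \<in> J\<close> J dc by auto
    ultimately show "((1 / d $ j) \<cdot>\<^sub>v d) $ k = (if k = j then 1 else 0)"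
      using dk dj by (cases "k = j") auto
  qed (use dL c in auto)
qed

text \<open>The dual vectors are combined with coefficients \<open>g j\<close>; the induction runs
  over the set \<open>K\<close> of coordinates already adjusted.\<close>

lemma dual_basis_interpolation:
  assumes L: "VectorSpace.subspace class_ring L V.V" and J: "J \<subseteq> {..<N}"
    and dual: "\<And>j. j \<in> J \<Longrightarrow> \<exists>d\<in>L. \<forall>k\<in>J. d $ k = (if k = j then 1 else 0)"
  shows "\<exists>v\<in>L. \<forall>j\<in>J. v $ j = g j"
proof -
  note c = V.subspace_closed[OF L]
  have "finite J" using J finite_subset by blast
  have "\<exists>v\<in>L. \<forall>j\<in>J. v $ j = (if j \<in> K then g j else 0)" if "finite K" "K \<subseteq> J" for K
    using that
  proof (induction K)
    case empty
    then show ?case using c(2) J by (intro bexI[of _ "0\<^sub>v N"]) auto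
  next
    case (insert k K)
    then obtain v where v: "v \<in> L" "\<forall>j\<in>J. v $ j = (if j \<in> K then g j else 0)" by auto
    obtain d where d: "d \<in> L" "\<forall>j\<in>J. d $ j = (if j = k then 1 else 0)" using dual[of k] insert by auto
    have "v + g k \<cdot>\<^sub>v d \<in> L" using v d c by blast
    moreover have "v \<in> carrier_vec N" "d \<in> carrier_vec N" using v d c by auto
    then have "\<forall>j\<in>J. (v + g k \<cdot>\<^sub>v d) $ j = (if j \<in> insert k K then g j else 0)"
      using v(2) d(2) J insert.hyps by auto
    ultimately show ?case by blast
  qed
  from this[OF \<open>finite J\<close> order_refl] show ?thesis by auto
qed

lemma general_position_generic_on:
  assumes gp: "general_position N L"
  shows "generic_on {..<N} (coords N ` L) (subspace_dim N L)"
proof -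
  define s where "s = subspace_dim N L"
  let ?p = "\<lambda>i. orth_proj L (unit_vec N i)"
  have L: "VectorSpace.subspace class_ring L V.V" using gp by (simp add: general_position_def)
  have li: "inj_on ?p J \<and> V.lin_indpt (?p ` J)" if "J \<subseteq> {..<N}" "card J = s" for J
    using gp that by (auto simp: general_position_def s_def)
  note c = V.subspace_closed[OF L]
  have sN: "s \<le> N" unfolding s_def subspace_dim_def using V.subspace_dim_le[OF L] .
  have pL: "?p i \<in> L" for i using orth_proj_props(1)[OF L unit_vec_carrier] .
  have sur: "\<exists>v\<in>L. \<forall>j\<in>J. v $ j = g j" if J: "J \<subseteq> {..<N}" "card J \<le> s" for J g
  proof -
    \<comment> \<open>General position speaks of exactly \<open>s\<close> axes, so a smaller
      \<open>J\<close> is first enlarged.\<close>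
    obtain J' where J': "J \<subseteq> J'" "J' \<subseteq> {..<N}" "card J' = s"
      using J sN exists_subset_between[of J s "{..<N}"] by auto
    have "\<exists>v\<in>L. \<forall>j\<in>J'. v $ j = g j"
      by (rule dual_basis_interpolation[OF L J'(2)])
        (rule dual_basis_vector[OF L J'(2) conjunct1[OF li[OF J'(2,3)]] conjunct2[OF li[OF J'(2,3)]]])
    then show ?thesis using J'(1) by blast
  qed
  have inj: "v $ i = 0" if J: "J \<subseteq> {..<N}" "card J = s" and v: "v \<in> L" "\<And>j. j \<in> J \<Longrightarrow> v $ j = 0" and i: "i < N"
    for J v i
  proof -
    have "finite J" using J finite_subset by blast
    then have span: "V.span (?p ` J) = L"
      using li[OF J] pL J
      by (intro V.indpt_card_dim_spans[OF L]) (auto simp: card_image s_def subspace_dim_def)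
    have vc: "v \<in> carrier_vec N" using v c by blast
    have pc: "?p k \<in> carrier_vec N" for k using pL c by blast
    have vp: "v \<bullet> ?p k = 0" if "k \<in> J" for k
      using scalar_prod_orth_proj_unit[OF L v(1), of k] that J v(2) vc pc
      by (auto simp: comm_scalar_prod[of _ N])
    \<comment> \<open>The vector \<open>v\<close> is orthogonal to the projected axes in
      \<open>J\<close>, and these span \<open>L\<close>, which contains \<open>v\<close>.\<close>
    have "v \<bullet> v = 0"
    proof (rule orthogonal_to_span[of "?p ` J"])
      show "?p ` J \<subseteq> carrier_vec N" using pc by blast
      show "v \<in> V.span (?p ` J)" unfolding span by (rule v(1))
      show "\<And>w. w \<in> ?p ` J \<Longrightarrow> v \<bullet> w = 0" using vp by blast
    qed (rule vc)
    then show ?thesis using scalar_prod_self_eq_0_iff[OF vc] i by simp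
  qed
  show ?thesis
    unfolding generic_on_def s_def[symmetric]
  proof (intro conjI allI impI ballI)
    fix J g assume J: "J \<subseteq> {..<N} \<and> card J \<le> s"
    then obtain v where "v \<in> L" "\<forall>j\<in>J. v $ j = g j" using sur by blast
    then show "\<exists>v\<in>coords N ` L. \<forall>j\<in>J. v j = g j" using J by (intro bexI[of _ "coords N v"]) (auto simp: coords_def)
  next
    fix J f i assume a: "J \<subseteq> {..<N} \<and> card J = s \<and> f \<in> coords N ` L \<and> (\<forall>j\<in>J. f j = 0)" "i \<in> {..<N}"
    then obtain v where v: "v \<in> L" "f = coords N v" by blast
    have "v $ j = 0" if "j \<in> J" for j using a v that by (auto simp: coords_def split: if_splits)
    then show "f i = 0" using inj[of J v i] a v by (auto simp: coords_def)
  qed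
qed

end

section \<open>Recoverability as a sign condition on the kernel\<close>

definition support :: "nat \<Rightarrow> real vec \<Rightarrow> nat set" where
  "support N u = {i. i < N \<and> u $ i = 1}"

text \<open>Moving from a binary \<open>u\<^sub>0\<close> in direction \<open>v\<close> stays in the cube for a short
  while iff \<open>v\<close> lies in the orthant of \<open>u\<^sub>0\<close>.\<close>

lemma not_recoverable_iff:
  assumes A: "dim_col A = N" and N: "N > 0" and u: "u \<in> binary_vecs N" and gp: "mat_general_position A"
  shows "\<not> recoverable A u \<longleftrightarrow>
    {..<N} - support N u \<in> patterns {..<N} (coords N ` mat_kernel A)"
proof -
  let ?L = "mat_kernel A" and ?X = "{..<N} - support N u"
  interpret V: vec_space "TYPE(real)" N .
  have gpN: "general_position N ?L" using gp A by (simp add: mat_general_position_def)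
  then have L: "VectorSpace.subspace class_ring ?L V.V" by (simp add: general_position_def)
  have Am: "A \<in> carrier_mat (dim_row A) N" using A by auto
  have uc: "u \<in> carrier_vec N" and ub: "\<And>i. i < N \<Longrightarrow> u $ i = 0 \<or> u $ i = 1"
    using u by (auto simp: binary_vecs_def)
  have uf: "u \<in> feasible A u" using uc ub A by (fastforce simp: feasible_def)
  have fin: "finite {..<N}" "{..<N} \<noteq> {}" using N by auto
  \<comment> \<open>Patterns record positive coordinates, and a direction in the orthant of
    \<open>u\<close> may be positive only where \<open>u\<close> is zero; hence the complement of
    the support.\<close>
  have "?X \<in> patterns {..<N} (coords N ` ?L) \<longleftrightarrow>
    (\<exists>f\<in>coords N ` ?L. (\<exists>i\<in>{..<N}. f i \<noteq> 0) \<and> (\<forall>i\<in>?X. f i \<ge> 0) \<and> (\<forall>i\<in>{..<N}-?X. f i \<le> 0))"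
    using closed_orthant_iff_patterns[OF fin lin_closed_coords[OF L] general_position_generic_on[OF gpN], of ?X]
    by blast
  also have "\<dots> \<longleftrightarrow> (\<exists>v\<in>?L. (\<exists>i<N. v $ i \<noteq> 0) \<and> (\<forall>i<N. (u $ i = 0 \<longrightarrow> v $ i \<ge> 0) \<and> (u $ i = 1 \<longrightarrow> v $ i \<le> 0)))"
  proof -
    have X: "i \<in> ?X \<longleftrightarrow> i < N \<and> u $ i = 0" "i \<in> {..<N} - ?X \<longleftrightarrow> i < N \<and> u $ i = 1" for i
      using ub[of i] by (auto simp: support_def)
    show ?thesis
      unfolding Ball_def X Set.bex_simps(7) by (intro bex_cong refl) (auto simp: coords_def)
  qed
  also have "\<dots> \<longleftrightarrow> \<not> recoverable A u"
  proof
    assume "\<exists>v\<in>?L. (\<exists>i<N. v $ i \<noteq> 0) \<and> (\<forall>i<N. (u $ i = 0 \<longrightarrow> v $ i \<ge> 0) \<and> (u $ i = 1 \<longrightarrow> v $ i \<le> 0))"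
    then obtain v k where v: "v \<in> ?L" "k < N" "v $ k \<noteq> 0"
      "\<And>i. i < N \<Longrightarrow> u $ i = 0 \<Longrightarrow> v $ i \<ge> 0" "\<And>i. i < N \<Longrightarrow> u $ i = 1 \<Longrightarrow> v $ i \<le> 0" by blast
    have vc: "v \<in> carrier_vec N" "A *\<^sub>v v = 0\<^sub>v (dim_row A)" using mat_kernelD[OF Am v(1)] by auto
    \<comment> \<open>Dividing by the largest absolute entry bounds every step by one, the side
      length of the cube.\<close>
    define m where "m = Max ((\<lambda>i. \<bar>v $ i\<bar>) ` {..<N})"
    have m: "\<bar>v $ i\<bar> \<le> m" if "i < N" for i unfolding m_def using that by (intro Max_ge) auto
    have mpos: "m > 0" using m[OF v(2)] v(3) by linarith
    define w where "w = u + (1 / m) \<cdot>\<^sub>v v"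
    have wi: "w $ i = u $ i + v $ i / m" if "i < N" for i using that uc vc by (simp add: w_def)
    have b: "\<bar>v $ i / m\<bar> \<le> 1" if "i < N" for i using m[OF that] mpos by (simp add: divide_le_eq)
    have "A *\<^sub>v w = A *\<^sub>v u + (1 / m) \<cdot>\<^sub>v (A *\<^sub>v v)"
      unfolding w_def using uc vc(1) by (simp add: mult_add_distrib_mat_vec[OF Am] mult_mat_vec[OF Am])
    also have "\<dots> = A *\<^sub>v u" unfolding vc by (intro eq_vecI) auto
    finally have "A *\<^sub>v w = A *\<^sub>v u" .
    moreover have "0 \<le> w $ i \<and> w $ i \<le> 1" if "i < N" for i
    proof -
      have "u $ i = 0 \<Longrightarrow> v $ i / m \<ge> 0" "u $ i = 1 \<Longrightarrow> v $ i / m \<le> 0"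
        using v(4,5)[OF that] mpos by (auto simp: zero_le_divide_iff divide_le_0_iff)
      then show ?thesis
        using ub[OF that] b[OF that] unfolding wi[OF that] by linarith
    qed
    ultimately have "w \<in> feasible A u" using uc vc A by (auto simp: feasible_def w_def)
    moreover have "w \<noteq> u" using wi[OF v(2)] v(3) mpos by auto
    ultimately show "\<not> recoverable A u" by (auto simp: recoverable_def)
  next
    assume "\<not> recoverable A u"
    then obtain w where w: "w \<in> feasible A u" "w \<noteq> u" using uf unfolding recoverable_def by blast
    have wc: "w \<in> carrier_vec N" "A *\<^sub>v w = A *\<^sub>v u" "\<And>i. i < N \<Longrightarrow> 0 \<le> w $ i \<and> w $ i \<le> 1"
      using w(1) A by (auto simp: feasible_def)
    have "w - u \<in> ?L"
    proof (rule mat_kernelI[OF Am])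
      show "A *\<^sub>v (w - u) = 0\<^sub>v (dim_row A)"
        using wc uc by (simp add: mult_minus_distrib_mat_vec[OF Am]) (intro eq_vecI; simp)
    qed (use wc uc in auto)
    moreover have "\<exists>i<N. (w - u) $ i \<noteq> 0"
    proof (rule ccontr)
      assume "\<not> (\<exists>i<N. (w - u) $ i \<noteq> 0)"
      then have "w = u" using wc uc by (intro eq_vecI) auto
      then show False using w by simp
    qed
    moreover have "\<forall>i<N. (u $ i = 0 \<longrightarrow> (w - u) $ i \<ge> 0) \<and> (u $ i = 1 \<longrightarrow> (w - u) $ i \<le> 0)"
      using wc uc by auto
    ultimately show "\<exists>v\<in>?L. (\<exists>i<N. v $ i \<noteq> 0) \<and> (\<forall>i<N. (u $ i = 0 \<longrightarrow> v $ i \<ge> 0) \<and> (u $ i = 1 \<longrightarrow> v $ i \<le> 0))"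
      by blast
  qed
  finally show ?thesis by blast
qed

section \<open>The recovery probability\<close>

text \<open>Closed orthants indexed by subsets. Here \<open>X\<close> collects the nonpositive
  coordinates, in agreement with \<open>support\<close> and opposite to
  \<open>has_pattern\<close>.\<close>

definition orthant :: "nat \<Rightarrow> nat set \<Rightarrow> real vec set" where
  "orthant N X = {v \<in> carrier_vec N. \<forall>x<N. (x \<in> X \<longrightarrow> v $ x \<le> 0) \<and> (x \<notin> X \<longrightarrow> v $ x \<ge> 0)}"

lemma signal_orthant_eq:
  assumes "u \<in> binary_vecs N"
  shows "signal_orthant N u = orthant N (support N u)"
  using assms unfolding signal_orthant_def orthant_def support_def binary_vecs_def by force

text \<open>An interior point of an orthant reveals all its signs.\<close>

lemma orthant_inject:
  assumes "X \<subseteq> {..<N}" "Y \<subseteq> {..<N}" "orthant N X = orthant N Y"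
  shows "X = Y"
proof -
  let ?w = "vec N (\<lambda>x. if x \<in> X then -1 else 1) :: real vec"
  have "?w \<in> orthant N X" by (auto simp: orthant_def)
  then have "?w \<in> orthant N Y" using assms(3) by simp
  then have "x \<in> X \<longleftrightarrow> x \<in> Y" if "x < N" for x
    using that by (auto simp: orthant_def split: if_splits)
  then show ?thesis using assms(1,2) by blast
qed

lemma uminus_orthant: "uminus ` orthant N X = orthant N ({..<N} - X)"
proof -
  have sub: "uminus ` orthant N X \<subseteq> orthant N ({..<N} - X)" for X
    by (auto simp: orthant_def)
  \<comment> \<open>Negation and complement are involutions, so the inclusion \<open>sub\<close>
    applied to the complement yields the reverse one.\<close>
  have "orthant N ({..<N} - X) = uminus ` uminus ` orthant N ({..<N} - X)"
    unfolding image_image by (auto simp: image_iff)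
  also have "\<dots> \<subseteq> uminus ` orthant N ({..<N} - ({..<N} - X))" using sub by (intro image_mono)
  also have "orthant N ({..<N} - ({..<N} - X)) = orthant N X"
    by (auto simp: orthant_def)
  finally show ?thesis using sub by blast
qed

lemma orthant_closed_orthant: "orthant N X \<in> closed_orthants N"
  unfolding closed_orthants_def orthant_def
  by (intro CollectI exI[of _ "\<lambda>x. if x \<in> X then -1 else 1"]) (auto split: if_splits)

lemma patterns_Compl:
  assumes "lin_closed L" "Y \<in> patterns I L"
  shows "I - Y \<in> patterns I L"
proof -
  obtain v where v: "Y \<subseteq> I" "v \<in> L" "has_pattern I v Y" using assms(2) by (auto simp: patterns_def)
  have "(\<lambda>i. (-1) * v i + 0 * v i) \<in> L" using lin_closedD[OF assms(1) v(2,2)] .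
  then have "(\<lambda>i. - v i) \<in> L" by simp
  then show ?thesis using v by (auto simp: patterns_def has_pattern_def intro!: bexI[of _ "\<lambda>i. - v i"])
qed

text \<open>The hypothesis on orthants fixes only the probability of each antipodal pair. This
  suffices because the set of bad supports is closed under complement, so its probability is half
  its cardinality times the pair probability.\<close>

lemma recovery_prob_eq:
  assumes A: "dim_col A = N" and N: "N > 0" and gp: "mat_general_position A"
    and rs: "random_binary_signal N M u" and wp: "without_orthant_preference N M u"
  shows "recovery_prob M A u = 1 - (\<Sum>k<N - mat_rank A. real ((N - 1) choose k)) / 2 ^ (N - 1)"
    and "mat_rank A \<le> N"
proof -
  interpret prob_space M using rs by (simp add: random_binary_signal_def)
  interpret V: vec_space "TYPE(real)" N .
  let ?I = "{..<N}"
  have um: "u \<in> M \<rightarrow>\<^sub>M count_space (binary_vecs N)" using rs by (simp add: random_binary_signal_def)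
  have ub: "u \<omega> \<in> binary_vecs N" if "\<omega> \<in> space M" for \<omega>
    using measurable_space[OF um that] by simp
  have ev[measurable]: "{\<omega> \<in> space M. Q (u \<omega>)} \<in> events" for Q
  proof -
    have "{\<omega> \<in> space M. Q (u \<omega>)} = u -` {x \<in> binary_vecs N. Q x} \<inter> space M" using ub by auto
    also have "\<dots> \<in> events" by (rule measurable_sets[OF um]) auto
    finally show ?thesis .
  qed
  define q where "q X = prob {\<omega> \<in> space M. support N (u \<omega>) = X}" for X
  have supp_sub: "support N x \<subseteq> ?I" for x by (auto simp: support_def)
  have q_sum: "prob {\<omega> \<in> space M. support N (u \<omega>) \<in> F} = sum q F" if "finite F" for F
  proof -
    have "{\<omega> \<in> space M. support N (u \<omega>) \<in> F} = (\<Union>X\<in>F. {\<omega> \<in> space M. support N (u \<omega>) = X})" by auto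
    also have "prob \<dots> = sum q F"
      unfolding q_def using that ev
      by (intro finite_measure_finite_Union) (auto simp: disjoint_family_on_def)
    finally show ?thesis .
  qed
  have pair: "prob {\<omega> \<in> space M. signal_orthant N (u \<omega>) \<in> {orthant N X, uminus ` orthant N X}} = q X + q (?I - X)"
    if X: "X \<subseteq> ?I" for X
  proof -
    \<comment> \<open>Positive dimension makes the two orthants of a pair distinct, so that their
      probabilities add.\<close>
    have ne: "X \<noteq> ?I - X" using N by blast
    have inj: "orthant N (support N x) = orthant N Y \<longleftrightarrow> support N x = Y" if "Y \<subseteq> ?I" for x Y
      using orthant_inject[OF supp_sub that] by metis
    have "signal_orthant N (u \<omega>) \<in> {orthant N X, uminus ` orthant N X}
        \<longleftrightarrow> support N (u \<omega>) \<in> {X, ?I - X}" if "\<omega> \<in> space M" for \<omega>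
      using X by (simp add: uminus_orthant signal_orthant_eq[OF ub[OF that]] inj)
    then have "{\<omega> \<in> space M. signal_orthant N (u \<omega>) \<in> {orthant N X, uminus ` orthant N X}}
        = {\<omega> \<in> space M. support N (u \<omega>) \<in> {X, ?I - X}}" by blast
    then show ?thesis using q_sum[of "{X, ?I - X}"] ne by simp
  qed
  define c where "c = q {} + q ?I"
  have const: "q X + q (?I - X) = c" if "X \<subseteq> ?I" for X
  proof -
    have "q X + q (?I - X) = q {} + q (?I - {})"
      unfolding pair[OF that, symmetric] pair[OF empty_subsetI, symmetric]
      using wp orthant_closed_orthant unfolding without_orthant_preference_def by blast
    then show ?thesis by (simp add: c_def)
  qed
  have compl_sum: "(\<Sum>X\<in>F. q (?I - X)) = sum q F"
    if "F \<subseteq> Pow ?I" "\<And>X. X \<in> F \<Longrightarrow> ?I - X \<in> F" for F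
  proof (rule sum.reindex_bij_witness[where i = "\<lambda>X. ?I - X" and j = "\<lambda>X. ?I - X"])
    fix X assume "X \<in> F"
    then have "X \<subseteq> ?I" using that(1) by blast
    then show "?I - (?I - X) = X" by blast
  qed (use that in auto)
  \<comment> \<open>Summing the pair identity over a complement-closed \<open>F\<close> counts each
    support twice. Taking all supports for \<open>F\<close> will determine \<open>c\<close>.\<close>
  have half: "2 * sum q F = real (card F) * c" if "F \<subseteq> Pow ?I" "\<And>X. X \<in> F \<Longrightarrow> ?I - X \<in> F" for F
  proof -
    have "2 * sum q F = sum q F + (\<Sum>X\<in>F. q (?I - X))" using compl_sum[OF that] by simp
    also have "\<dots> = (\<Sum>X\<in>F. c)" unfolding sum.distrib[symmetric] using const that(1) by (intro sum.cong) auto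
    finally show ?thesis by simp
  qed
  have "sum q (Pow ?I) = 1"
    using q_sum[of "Pow ?I"] supp_sub prob_space by simp
  then have c: "2 = 2 ^ N * c" using half[of "Pow ?I"] by (simp add: card_Pow)
  let ?L = "mat_kernel A"
  let ?P = "patterns ?I (coords N ` ?L)"
  have gpN: "general_position N ?L" using gp A by (simp add: mat_general_position_def)
  then have L: "VectorSpace.subspace class_ring ?L V.V" by (simp add: general_position_def)
  have rn: "mat_rank A + subspace_dim N ?L = N"
    unfolding mat_rank_def subspace_dim_def
    by (rule V.rank_nullity_mat) (metis A carrier_matI)
  then show "mat_rank A \<le> N" by simp
  have dimL: "subspace_dim N ?L = N - mat_rank A" using rn by simp
  have cP: "card ?P = 2 * (\<Sum>k<N - mat_rank A. (N - 1) choose k)"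
    using card_patterns[OF _ _ lin_closed_coords[OF L] general_position_generic_on[OF gpN]] N
    by (auto simp: lessThan_empty_iff dimL)
  have P_sub: "?P \<subseteq> Pow ?I" using patterns_subset by blast
  have P_compl: "X \<in> ?P \<Longrightarrow> ?I - X \<in> ?P" for X using patterns_Compl[OF lin_closed_coords[OF L]] .
  have "support N (u \<omega>) \<in> ?P \<longleftrightarrow> \<not> recoverable A (u \<omega>)" if "\<omega> \<in> space M" for \<omega>
  proof -
    have "?I - (?I - support N (u \<omega>)) = support N (u \<omega>)" using supp_sub by blast
    \<comment> \<open>\<open>not_recoverable_iff\<close> concerns the complement of the support;
      symmetry of the patterns under negation removes the complement.\<close>
    then have "support N (u \<omega>) \<in> ?P \<longleftrightarrow> ?I - support N (u \<omega>) \<in> ?P" using P_compl by metis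
    then show ?thesis using not_recoverable_iff[OF A N ub[OF that] gp] by simp
  qed
  then have "{\<omega> \<in> space M. recoverable A (u \<omega>)} = space M - {\<omega> \<in> space M. support N (u \<omega>) \<in> ?P}" by auto
  then have "recovery_prob M A u = 1 - sum q ?P"
    unfolding recovery_prob_def using prob_compl[OF ev, of "\<lambda>x. support N x \<in> ?P"] q_sum finite_subset[OF P_sub] by simp
  moreover have "sum q ?P = real (\<Sum>k<N - mat_rank A. (N - 1) choose k) / 2 ^ (N - 1)"
  proof -
    have "2 * sum q ?P = real (card ?P) * c" by (rule half[OF P_sub P_compl])
    moreover have "c = 1 / 2 ^ (N - 1)" using c N by (cases N) (auto simp: field_simps)
    ultimately show ?thesis by (simp add: cP)
  qed
  ultimately show "recovery_prob M A u = 1 - (\<Sum>k<N - mat_rank A. real ((N - 1) choose k)) / 2 ^ (N - 1)" by simp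
qed

section \<open>Binomial sums as tails of the fair binomial law\<close>

lemma pmf_binomial_half: "pmf (binomial_pmf n (1/2)) k = real (n choose k) / 2 ^ n"
proof (cases "k \<le> n")
  case True
  then have "(1/2::real) ^ k * (1/2) ^ (n - k) = 1 / 2 ^ n"
    by (simp add: power_add[symmetric] power_one_over)
  then show ?thesis by (simp add: mult.assoc)
qed (simp add: binomial_eq_0)

text \<open>The reflection of \<open>k\<close> to \<open>N - 1 - k\<close> turns the first
  \<open>N - r\<close> coefficients into those from \<open>r\<close> on. The head serves the normal
  approximation, the tail the exponential bound.\<close>

lemma sum_choose_binomial_pmf:
  assumes "r \<le> N" "N > 0"
  shows "1 - (\<Sum>k<N - r. real ((N - 1) choose k)) / 2 ^ (N - 1)
           = measure_pmf.prob (binomial_pmf (N - 1) (1/2)) {k. k < r}"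
    and "(\<Sum>k<N - r. real ((N - 1) choose k)) / 2 ^ (N - 1)
           = measure_pmf.prob (binomial_pmf (N - 1) (1/2)) {k. r \<le> k}"
proof -
  define n where "n = N - 1"
  have N: "N = Suc n" using assms by (simp add: n_def)
  let ?B = "binomial_pmf n (1/2)"
  have "measure_pmf.prob ?B {k. r \<le> k} = measure_pmf.prob ?B {r..n}"
    by (rule measure_prob_cong_0) (auto simp: pmf_binomial_half binomial_eq_0)
  also have "\<dots> = (\<Sum>k\<in>{r..n}. real (n choose k) / 2 ^ n)"
    by (simp add: measure_measure_pmf_finite pmf_binomial_half)
  also have "\<dots> = (\<Sum>k<N - r. real (n choose k) / 2 ^ n)"
    using assms(1) unfolding N
    by (intro sum.reindex_bij_witness[where i = "\<lambda>k. n - k" and j = "\<lambda>k. n - k"])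
      (auto simp: binomial_symmetric[symmetric])
  finally show *: "(\<Sum>k<N - r. real ((N - 1) choose k)) / 2 ^ (N - 1)
           = measure_pmf.prob (binomial_pmf (N - 1) (1/2)) {k. r \<le> k}"
    by (simp add: n_def sum_divide_distrib)
  have "{k. k < r} = UNIV - {k. r \<le> k}" by auto
  then show "1 - (\<Sum>k<N - r. real ((N - 1) choose k)) / 2 ^ (N - 1)
           = measure_pmf.prob (binomial_pmf (N - 1) (1/2)) {k. k < r}"
    unfolding * using measure_pmf.prob_compl[of "{k. r \<le> k}" "binomial_pmf (N - 1) (1/2)"] by simp
qed

section \<open>Asymptotics of the binomial distribution\<close>

text \<open>The limit of characteristic functions behind the central limit theorem. The expansion is
  carried out for positive \<open>t\<close>; evenness of the cosine covers negative
  \<open>t\<close>.\<close>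

lemma tendsto_cos_power: "(\<lambda>n. cos (t / sqrt (real n)) ^ n) \<longlonglongrightarrow> exp (- (t\<^sup>2) / 2)"
proof -
  have pos: "(\<lambda>n. cos (t / sqrt (real n)) ^ n) \<longlonglongrightarrow> exp (- (t * t / 2))" if "t > 0" for t :: real
    using that by real_asymp
  show ?thesis
    using pos[of t] pos[of "-t"] by (cases t "0::real" rule: linorder_cases) (auto simp: power2_eq_square)
qed

text \<open>The standardised binomial law: the mean is \<open>n / 2\<close> and the standard
  deviation \<open>sqrt n / 2\<close>.\<close>

definition scaled_binomial :: "nat \<Rightarrow> real measure" where
  "scaled_binomial n =
     distr (measure_pmf (binomial_pmf n (1/2))) borel (\<lambda>k. (2 * real k - real n) / sqrt (real n))"

lemma real_distribution_scaled_binomial: "real_distribution (scaled_binomial n)"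
  unfolding scaled_binomial_def by (intro prob_space.real_distribution_distr measure_pmf.prob_space_axioms) simp

text \<open>The law is that of a normalised sum of \<open>n\<close> independent fair signs, each
  contributing one cosine factor; the binomial theorem performs this factorisation.\<close>

lemma char_scaled_binomial: "char (scaled_binomial n) t = of_real (cos (t / sqrt (real n)) ^ n)"
proof -
  define th where "th = t / sqrt (real n)"
  let ?f = "\<lambda>k. iexp (t * ((2 * real k - real n) / sqrt (real n)))"
  \<comment> \<open>Since \<open>2 * k - n\<close> equals \<open>k - (n - k)\<close>, the
    exponential splits into \<open>k\<close> factors of one sign and \<open>n - k\<close> of the
    other.\<close>
  have f: "?f k = iexp th ^ k * iexp (- th) ^ (n - k)" if "k \<le> n" for k
  proof -
    have "iexp th ^ k * iexp (- th) ^ (n - k) = exp (of_nat k * (\<i> * of_real th) + of_nat (n - k) * (\<i> * of_real (- th)))"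
      by (simp only: exp_of_nat_mult exp_add)
    also have "of_nat k * (\<i> * of_real th) + of_nat (n - k) * (\<i> * of_real (- th)) =
       \<i> * of_real (t * ((2 * real k - real n) / sqrt (real n)))"
      using that by (simp add: th_def of_nat_diff algebra_simps diff_divide_distrib)
    finally show ?thesis by simp
  qed
  have "char (scaled_binomial n) t = (CLINT k|measure_pmf (binomial_pmf n (1/2)). ?f k)"
    unfolding char_def scaled_binomial_def by (subst integral_distr) auto
  also have "\<dots> = (\<Sum>k\<le>n. pmf (binomial_pmf n (1/2)) k *\<^sub>R ?f k)"
    by (rule integral_measure_pmf) (auto simp: set_pmf_binomial_eq split: if_splits)
  also have "\<dots> = (\<Sum>k\<le>n. of_nat (n choose k) * iexp th ^ k * iexp (- th) ^ (n - k)) / 2 ^ n"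
    unfolding sum_divide_distrib
    by (intro sum.cong refl, subst f) (simp_all add: pmf_binomial_half scaleR_conv_of_real)
  also have "\<dots> = ((iexp th + iexp (- th)) / 2) ^ n"
    unfolding binomial_ring power_divide by simp
  also have "(iexp th + iexp (- th)) / 2 = of_real (cos th)"
    unfolding cis_conv_exp[symmetric] by (simp add: complex_eq_iff)
  finally show ?thesis by (simp add: th_def)
qed

lemma scaled_binomial_weak_conv: "weak_conv_m scaled_binomial std_normal_distribution"
proof (rule levy_continuity[OF real_distribution_scaled_binomial real_dist_normal_dist])
  show "(\<lambda>n. char (scaled_binomial n) t) \<longlonglongrightarrow> char std_normal_distribution t" for t
    unfolding char_scaled_binomial char_std_normal_distribution
    by (intro tendsto_of_real tendsto_cos_power)
qed

lemma cdf_std_normal: "cdf std_normal_distribution x = Phi x"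
proof -
  have "cdf std_normal_distribution x = (LINT t|std_normal_distribution. indicator {..x} t)"
    by (simp add: cdf_def)
  also have "\<dots> = (LINT t|lborel. std_normal_density t *\<^sub>R indicator {..x} t)"
    by (subst integral_density) auto
  also have "\<dots> = (LINT t|lborel. 1 / sqrt (2 * pi) * (indicator {..x} t *\<^sub>R exp (- t\<^sup>2 / 2)))"
    by (intro Bochner_Integration.integral_cong) (auto simp: std_normal_density_def)
  also have "\<dots> = Phi x"
    unfolding Phi_def set_lebesgue_integral_def by (rule integral_mult_right_zero)
  finally show ?thesis .
qed

lemma isCont_cdf_std_normal: "isCont (cdf std_normal_distribution) x"
proof -
  interpret real_distribution std_normal_distribution by (rule real_dist_normal_dist)
  have "measure std_normal_distribution {x} = (LINT t|std_normal_distribution. indicator {x} t)"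
    by simp
  also have "\<dots> = (LINT t|lborel. std_normal_density t *\<^sub>R indicator {x} t)"
    by (subst integral_density) auto
  also have "\<dots> = integral\<^sup>L lborel (\<lambda>t::real. 0)"
  proof (rule integral_cong_AE)
    show "AE t in lborel. std_normal_density t *\<^sub>R indicator {x} t = (0::real)"
      using AE_lborel_singleton[of x] by eventually_elim simp
  qed auto
  finally show ?thesis unfolding isCont_cdf by simp
qed

text \<open>Polya: monotonicity and boundedness upgrade pointwise convergence to a continuous
  distribution function to uniform convergence, via finitely many quantiles of the limit.\<close>

lemma weak_conv_uniform:
  assumes M: "\<And>n. real_distribution (M n)" and M': "real_distribution M'"
    and conv: "weak_conv_m M M'" and cont: "\<And>x. isCont (cdf M') x" and e: "e > 0"
  shows "\<forall>\<^sub>F n in sequentially. \<forall>x. \<bar>cdf (M n) x - cdf M' x\<bar> < e"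
proof -
  interpret M': real_distribution M' by fact
  let ?G = "cdf M'"
  \<comment> \<open>The mesh of the quantiles is \<open>1 / m\<close>. One mesh width is lost
    between quantiles and one to convergence at them; the third makes the final bound
    strict.\<close>
  obtain m :: nat where m: "3 / e < real m" using reals_Archimedean2 by blast
  have "3 / e > 0" using e by simp
  then have mpos: "real m > 0" using m by linarith
  have m3: "3 / real m < e" using m e mpos by (simp add: field_simps)
  have "\<exists>y. ?G y = real k / real m" if "k \<in> {0<..<m}" for k
  proof -
    have c: "0 < real k / real m" "real k / real m < 1" using that by auto
    obtain a where a: "?G a < real k / real m"
      using eventually_happens'[OF _ order_tendstoD(2)[OF M'.cdf_lim_at_bot c(1)]] by auto
    obtain b where b: "?G b > real k / real m"
      using eventually_happens'[OF _ order_tendstoD(1)[OF M'.cdf_lim_at_top_prob c(2)]] by auto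
    have "a \<le> b" using a b M'.cdf_nondecreasing[of b a] by linarith
    then show ?thesis using IVT[of ?G a "real k / real m" b] a b cont by auto
  qed
  then obtain y where y: "\<And>k. k \<in> {0<..<m} \<Longrightarrow> ?G (y k) = real k / real m" by metis
  have "\<forall>\<^sub>F n in sequentially. \<forall>k\<in>{0<..<m}. \<bar>cdf (M n) (y k) - ?G (y k)\<bar> < 1 / real m"
  proof (intro eventually_ball_finite ballI)
    fix k
    have "(\<lambda>n. cdf (M n) (y k)) \<longlonglongrightarrow> ?G (y k)"
      using conv cont unfolding weak_conv_m_def weak_conv_def by blast
    then show "\<forall>\<^sub>F n in sequentially. \<bar>cdf (M n) (y k) - ?G (y k)\<bar> < 1 / real m"
      using tendstoD[of _ "?G (y k)" sequentially "1 / real m"] mpos by (simp add: dist_real_def)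
  qed simp
  then show ?thesis
  proof eventually_elim
    case (elim n)
    interpret Mn: real_distribution "M n" by fact
    show ?case
    proof
      fix x
      have G01: "0 \<le> ?G x" "?G x \<le> 1" using M'.cdf_nonneg M'.cdf_bounded_prob by auto
      have F01: "0 \<le> cdf (M n) x" "cdf (M n) x \<le> 1" using Mn.cdf_nonneg Mn.cdf_bounded_prob by auto
      have up: "cdf (M n) x \<le> ?G x + 2 / real m"
      proof -
        \<comment> \<open>The least integer strictly above \<open>real m * ?G x\<close>, so that the
          quantile \<open>y k\<close> lies to the right of \<open>x\<close>. Without such a
          quantile, the trivial bound one is good enough.\<close>
        define k where "k = Suc (nat \<lfloor>real m * ?G x\<rfloor>)"
        have "0 \<le> real m * ?G x" using G01 mpos by simp
        then have k: "real k > real m * ?G x" "real k \<le> real m * ?G x + 1" unfolding k_def by linarith+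
        have k': "real k / real m > ?G x" "real k / real m \<le> ?G x + 1 / real m"
          using k mpos by (auto simp: field_simps)
        show ?thesis
        proof (cases "k < m")
          case True
          then have km: "k \<in> {0<..<m}" by (simp add: k_def)
          have "x \<le> y k" using M'.cdf_nondecreasing[of "y k" x] y[OF km] k' by linarith
          then have "cdf (M n) x \<le> cdf (M n) (y k)" by (rule Mn.cdf_nondecreasing)
          also have "\<dots> \<le> real k / real m + 1 / real m" using bspec[OF elim km] unfolding y[OF km] abs_less_iff by linarith
          also have "\<dots> \<le> ?G x + 2 / real m" using k'(2) by (simp add: field_simps)
          finally show ?thesis .
        next
          case False
          then have "1 \<le> real k / real m" using mpos by (simp add: field_simps)
          moreover have "1 / real m \<le> 2 / real m" using mpos by (simp add: divide_right_mono)
          ultimately show ?thesis using k'(2) F01 by linarith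
        qed
      qed
      have low: "cdf (M n) x \<ge> ?G x - 2 / real m"
      proof -
        \<comment> \<open>The greatest integer strictly below \<open>real m * ?G x\<close>, cut off
          at zero; a positive \<open>k\<close> gives a quantile to the left of \<open>x\<close>, and
          for \<open>k = 0\<close> the bound is trivial.\<close>
        define k where "k = nat (\<lceil>real m * ?G x\<rceil> - 1)"
        have k: "real k \<ge> real m * ?G x - 1" unfolding k_def by linarith
        have k'': "?G x - 1 / real m \<le> real k / real m"
          using divide_right_mono[OF k, of "real m"] mpos by (simp add: diff_divide_distrib)
        show ?thesis
        proof (cases "k = 0")
          case True
          then have "?G x \<le> 1 / real m" using k'' by simp
          also have "\<dots> \<le> 2 / real m" using mpos by (simp add: divide_right_mono)
          finally show ?thesis using F01 by linarith
        next
          case False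
          then have k2: "real k < real m * ?G x" unfolding k_def by linarith
          also have "\<dots> \<le> real m" using G01 mpos by (simp add: mult_le_cancel_left1)
          finally have km: "k \<in> {0<..<m}" using False by simp
          have "real k / real m < ?G x" using k2 mpos by (simp add: field_simps)
          then have "y k \<le> x" using M'.cdf_nondecreasing[of x "y k"] y[OF km] by linarith
          then have "cdf (M n) (y k) \<le> cdf (M n) x" by (rule Mn.cdf_nondecreasing)
          moreover have "real k / real m - 1 / real m \<le> cdf (M n) (y k)" using bspec[OF elim km] unfolding y[OF km] abs_less_iff by linarith
          moreover have "?G x - 2 / real m \<le> real k / real m - 1 / real m" using k'' by (simp add: field_simps)
          ultimately show ?thesis by linarith
        qed
      qed
      have "2 / real m < 3 / real m" using mpos by (simp add: divide_strict_right_mono)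
      then show "\<bar>cdf (M n) x - ?G x\<bar> < e" using up low m3 by linarith
    qed
  qed
qed

text \<open>With \<open>N = Suc n\<close>, the numerator \<open>2 * r - N - 1\<close> equals
  \<open>2 * (r - 1) - n\<close>. The threshold is therefore the lattice point of
  \<open>r - 1\<close>, and the closed inequality of the distribution function becomes
  \<open>k < r\<close>.\<close>

lemma cdf_scaled_binomial:
  assumes "n > 0"
  shows "cdf (scaled_binomial n) ((2 * real r - real (Suc n) - 1) / sqrt (real n))
           = measure_pmf.prob (binomial_pmf n (1/2)) {k. k < r}"
proof -
  have "cdf (scaled_binomial n) ((2 * real r - real (Suc n) - 1) / sqrt (real n)) =
    measure_pmf.prob (binomial_pmf n (1/2))
      {k. (2 * real k - real n) / sqrt (real n) \<le> (2 * real r - real (Suc n) - 1) / sqrt (real n)}"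
    unfolding cdf_def2 scaled_binomial_def by (subst measure_distr) (auto intro!: arg_cong2[where f = measure])
  also have "(\<lambda>k. (2 * real k - real n) / sqrt (real n) \<le> (2 * real r - real (Suc n) - 1) / sqrt (real n))
      = (\<lambda>k. k < r)"
    using assms by (auto simp: divide_le_cancel fun_eq_iff)
  finally show ?thesis .
qed

text \<open>Deviation \<open>9/10 * d\<close> gives the Hoeffding exponent
  \<open>1.62 * d\<^sup>2 * n\<close>. Once \<open>d\<^sup>2 * n\<close> is at least 2, the surplus
  \<open>0.62 * d\<^sup>2 * n\<close> exceeds 1, and \<open>exp (-1)\<close> is at most the
  prefactor \<open>1/2\<close>. The factor \<open>9/10\<close> leaves room for a ratio that only
  converges.\<close>

lemma hoeffding_half:
  assumes n: "n > 0" and d: "d > 0" and r: "real r / real n \<ge> 1/2 + 9/10 * d" and ln2: "d\<^sup>2 * real n \<ge> 2"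
  shows "measure_pmf.prob (binomial_pmf n (1/2)) {k. r \<le> k} \<le> 1 / 2 * exp (- (d\<^sup>2 * real n))"
proof -
  interpret binomial_distribution n "1/2" by unfold_locales simp
  have "measure_pmf.prob (binomial_pmf n (1/2)) {k. r \<le> k}
      \<le> measure_pmf.prob (binomial_pmf n (1/2)) {k. real k / real n \<ge> 1/2 + 9/10 * d}"
  proof (rule measure_pmf.finite_measure_mono)
    show "{k. r \<le> k} \<subseteq> {k. real k / real n \<ge> 1/2 + 9/10 * d}"
    proof safe
      fix k assume "r \<le> k"
      then have "real r / real n \<le> real k / real n" by (intro divide_right_mono) auto
      then show "real k / real n \<ge> 1/2 + 9/10 * d" using r by linarith
    qed
  qed simp
  also have "\<dots> \<le> exp (- 2 * real n * (9/10 * d)\<^sup>2)"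
    using prob_ge'[OF n, of "9/10 * d"] d by simp
  also have "\<dots> \<le> exp (- (1 + d\<^sup>2 * real n))"
    using ln2 by (simp add: power2_eq_square algebra_simps)
  also have "\<dots> = exp (-1) * exp (- (d\<^sup>2 * real n))" by (simp flip: exp_add)
  also have "\<dots> \<le> 1/2 * exp (- (d\<^sup>2 * real n))"
  proof (rule mult_right_mono)
    have "2 \<le> exp (1::real)" using exp_ge_add_one_self[of 1] by simp
    then show "exp (-1) \<le> (1/2::real)" by (simp add: exp_minus field_simps)
  qed simp
  finally show ?thesis .
qed

theorem mainTheorem2:
  fixes S :: "nat set"
    and A :: "nat \<Rightarrow> real mat"
    and r :: "nat \<Rightarrow> nat"
    and M :: "nat \<Rightarrow> 'a measure"
    and u0 :: "nat \<Rightarrow> 'a \<Rightarrow> real vec"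
  assumes "infinite S" and "\<And>N. N \<in> S \<Longrightarrow> N > 0"
    and "\<And>N. N \<in> S \<Longrightarrow> dim_col (A N) = N"
    and "\<And>N. N \<in> S \<Longrightarrow> mat_rank (A N) = r N"
    and "\<And>N. N \<in> S \<Longrightarrow> mat_general_position (A N)"
    and "\<And>N. N \<in> S \<Longrightarrow> random_binary_signal N (M N) (u0 N)"
    and "\<And>N. N \<in> S \<Longrightarrow> without_orthant_preference N (M N) (u0 N)"
  shows "((\<lambda>N. recovery_prob (M N) (A N) (u0 N)
              - Phi ((2 * real (r N) - real N - 1) / sqrt (real N - 1))) \<longlongrightarrow> 0)
           (at_infinity_in S)
       \<and> (\<forall>\<rho>::real. \<rho> > 1 / 2 \<longrightarrow>
            ((\<lambda>N. (real (r N) - 1) / (real N - 1)) \<longlongrightarrow> \<rho>) (at_infinity_in S) \<longrightarrow>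
            (\<forall>\<^sub>F N in at_infinity_in S.
               recovery_prob (M N) (A N) (u0 N)
                 \<ge> 1 - 1 / 2 * exp (- ((\<rho> - 1 / 2)\<^sup>2 * (real N - 1)))))"
proof -
  let ?F = "at_infinity_in S"
  let ?p = "\<lambda>N. recovery_prob (M N) (A N) (u0 N)"
  have inS: "\<forall>\<^sub>F N in ?F. N \<in> S"
    unfolding at_infinity_in_def by (simp add: eventually_inf_principal)
  have le: "?F \<le> sequentially" by (simp add: at_infinity_in_def)
  have pred: "filterlim (\<lambda>N. N - 1) sequentially ?F"
    using filterlim_mono[OF filterlim_minus_const_nat_at_top order_refl le] .
  have large: "\<forall>\<^sub>F N in ?F. N \<ge> 2" using le eventually_ge_at_top unfolding le_filter_def by blast
  have p: "?p N = measure_pmf.prob (binomial_pmf (N - 1) (1/2)) {k. k < r N}"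
    "1 - ?p N = measure_pmf.prob (binomial_pmf (N - 1) (1/2)) {k. r N \<le> k}" if "N \<in> S" for N
  proof -
    have "?p N = 1 - (\<Sum>k<N - r N. real ((N - 1) choose k)) / 2 ^ (N - 1)" "r N \<le> N"
      using recovery_prob_eq[OF assms(3,2,5,6,7)[OF that]] assms(4)[OF that] by auto
    then show "?p N = measure_pmf.prob (binomial_pmf (N - 1) (1/2)) {k. k < r N}"
      "1 - ?p N = measure_pmf.prob (binomial_pmf (N - 1) (1/2)) {k. r N \<le> k}"
      using sum_choose_binomial_pmf[OF _ assms(2)[OF that], of "r N"] by auto
  qed
  have part1: "((\<lambda>N. ?p N - Phi ((2 * real (r N) - real N - 1) / sqrt (real N - 1))) \<longlongrightarrow> 0) ?F"
  proof (rule tendstoI)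
    fix e :: real assume "e > 0"
    \<comment> \<open>Uniformity in \<open>x\<close> allows the argument to be chosen afterwards in
      dependence on \<open>N\<close>.\<close>
    then have "\<forall>\<^sub>F n in sequentially. \<forall>x. \<bar>cdf (scaled_binomial n) x - Phi x\<bar> < e"
      using weak_conv_uniform[OF real_distribution_scaled_binomial real_dist_normal_dist
          scaled_binomial_weak_conv isCont_cdf_std_normal] by (simp add: cdf_std_normal)
    then have "\<forall>\<^sub>F N in ?F. \<forall>x. \<bar>cdf (scaled_binomial (N - 1)) x - Phi x\<bar> < e"
      by (rule eventually_compose_filterlim[OF _ pred])
    with inS large show "\<forall>\<^sub>F N in ?F. dist (?p N - Phi ((2 * real (r N) - real N - 1) / sqrt (real N - 1))) 0 < e"
    proof eventually_elim
      case (elim N)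
      have N: "real (N - 1) = real N - 1" "Suc (N - 1) = N" using elim by auto
      have "?p N = cdf (scaled_binomial (N - 1)) ((2 * real (r N) - real N - 1) / sqrt (real N - 1))"
        using cdf_scaled_binomial[of "N - 1" "r N"] p(1)[OF elim(1)] elim(2) unfolding N by simp
      then show ?case using elim(3) by (simp add: dist_real_def)
    qed
  qed
  have part2: "\<forall>\<^sub>F N in ?F. ?p N \<ge> 1 - 1 / 2 * exp (- ((\<rho> - 1 / 2)\<^sup>2 * (real N - 1)))"
    if rho: "\<rho> > 1 / 2" and lim: "((\<lambda>N. (real (r N) - 1) / (real N - 1)) \<longlongrightarrow> \<rho>) ?F" for \<rho>
  proof -
    define d where "d = \<rho> - 1 / 2"
    have d: "d > 0" using rho by (simp add: d_def)
    have "1/2 + 9/10 * d < \<rho>" using d d_def by linarith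
    then have "\<forall>\<^sub>F N in ?F. (real (r N) - 1) / (real N - 1) > 1/2 + 9/10 * d"
      by (rule order_tendstoD(1)[OF lim])
    \<comment> \<open>From here on \<open>d\<^sup>2 * (N - 1)\<close> is at least 2, as the
      Hoeffding estimate requires.\<close>
    moreover have "\<forall>\<^sub>F N in ?F. N \<ge> nat \<lceil>2 / d\<^sup>2 + 1\<rceil>"
      using le eventually_ge_at_top unfolding le_filter_def by blast
    ultimately show ?thesis using inS large
    proof eventually_elim
      case (elim N)
      have N: "real (N - 1) = real N - 1" using elim by auto
      have "real N \<ge> 2 / d\<^sup>2 + 1" using elim(2) by linarith
      then have "2 \<le> d\<^sup>2 * real (N - 1)" using d unfolding N by (simp add: field_simps)
      \<comment> \<open>The limit concerns \<open>r - 1\<close>, the tail bound \<open>r\<close>;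
        the larger numerator only helps.\<close>
      moreover have "(real (r N) - 1) / real (N - 1) \<le> real (r N) / real (N - 1)"
        by (intro divide_right_mono) auto
      then have "real (r N) / real (N - 1) \<ge> 1/2 + 9/10 * d" using elim(1) unfolding N by linarith
      ultimately have "1 - ?p N \<le> 1 / 2 * exp (- (d\<^sup>2 * real (N - 1)))"
        unfolding p(2)[OF elim(3)] using elim(4) d by (intro hoeffding_half) auto
      then show ?case unfolding N d_def by linarith
    qed
  qed
  show ?thesis using part1 part2 by blast
qed

end
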